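(* Let $d\ge 1$ and $N\ge 2$ be integers, $\lambda_1,\dots,\lambda_N>0$, and $p>0$. Take $n\in\mathbb{N}$ such that $\frac{1}{n+1}\le p<\frac1n$. Let $x\in\mathcal X$ and $v\in\mathcal Y$. (i) If $p>\frac{1}{n+1}$, then there exist $c^1,\dots,c^n\in\mathcal X$ independent of $x$, and $T_0>0$, such that the $N$-body system has a unique solution $P(t)=(\alpha(t),\beta(t))$ for $t>T_0$ with $$\alpha(t)=x+vt+\sum_{k=1}^n c^k t^{1-kp}+O\big(t^{1-(n+1)p}\big),\qquad \beta(t)=v+\sum_{k=1}^n(1-kp)c^kt^{-kp}+O\big(t^{-(n+1)p}\big)$$ as $t\to+\infty$. (ii) If $p=\frac1{n+1}$, then there exist $c^1,\dots,c^{n+1}\in\mathcal X$ independent of $x$, and $T_0>0$, such that the $N$-body system has a unique solution $P(t)=(\alpha(t),\beta(t))$ for $t>T_0$ with $$\alpha(t)=x+vt+\sum_{k=1}^n c^kt^{1-kp}+c^{n+1}\log t+O\big(t^{1-(n+2)p}\log t\big),$$ $$\beta(t)=v+\sum_{k=1}^n(1-kp)c^kt^{-kp}+\frac{c^{n+1}}{t}+O\big(t^{-(n+2)p}\log t\big)$$ as $t\to+\infty$.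
   Context: $\mathbb N$ includes $0$, with the convention $1/0=+\infty$ (so $n=0$ when $p\ge1$) and empty sums equal to $0$. $\mathcal X=\mathbb R^{dN}=(\mathbb R^d)^N$, with elements written $\alpha=(\alpha_1,\dots,\alpha_N)$, $\alpha_i\in\mathbb R^d$, and $\mathcal Y=\{\alpha\in\mathcal X:\alpha_j\ne\alpha_k\ \forall j\ne k\}$. The $N$-body system (with masses $\lambda_i$ and parameter $p$) is the system for $P=(\alpha,\beta)$, $\alpha(t),\beta(t)\in\mathcal X$, $$\dot\alpha_i=\beta_i,\qquad \lambda_i\dot\beta_i=-\sum_{j\ne i}\frac{\lambda_i\lambda_j(\alpha_i-\alpha_j)}{|\alpha_i-\alpha_j|^{p+2}},\qquad i=1,\dots,N.$$ A solution for $t>T_0$ takes values $\alpha(t)\in\mathcal Y$. The data $d,N,\lambda_i,p$ are fixed; "$c^k$ independent of $x$" means that, given $v$, the same $c^k$ work for all $x\in\mathcal X$. *)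

theory Defs
  imports "HOL-Analysis.Analysis" "HOL-Library.Landau_Symbols"
begin

text \<open>The bodies are indexed by the finite type \<open>'N\<close>, so \<open>(\<real>\<^sup>d)\<^sup>N\<close> is the type \<open>real^'d^'N\<close>.\<close>

definition collision_free :: "(real^'d^'N) set" where
  "collision_free = {a. \<forall>j k. j \<noteq> k \<longrightarrow> a $ j \<noteq> a $ k}"

definition nbody_solution ::
  "('N::finite \<Rightarrow> real) \<Rightarrow> real \<Rightarrow> real \<Rightarrow> (real \<Rightarrow> real^'d^'N) \<Rightarrow> (real \<Rightarrow> real^'d^'N) \<Rightarrow> bool" where
  "nbody_solution m p T0 \<alpha> \<beta> \<longleftrightarrow>
     (\<forall>t>T0. \<alpha> t \<in> collision_free \<and>
       (\<forall>i. ((\<lambda>s. \<alpha> s $ i) has_vector_derivative \<beta> t $ i) (at t) \<and>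
            (\<exists>b. ((\<lambda>s. \<beta> s $ i) has_vector_derivative b) (at t) \<and>
                 m i *\<^sub>R b =
                   - (\<Sum>j\<in>UNIV - {i}.
                        (m i * m j / norm (\<alpha> t $ i - \<alpha> t $ j) powr (p + 2)) *\<^sub>R (\<alpha> t $ i - \<alpha> t $ j)))))"

text \<open>A solution for \<open>t > T0\<close> is represented by total functions of \<open>t\<close>, whose values for \<open>t \<le> T0\<close> are
  irrelevant; uniqueness is therefore agreement on \<open>t > T0\<close>.\<close>

definition has_unique_nbody_solution ::
  "('N::finite \<Rightarrow> real) \<Rightarrow> real \<Rightarrow> real \<Rightarrow>
    ((real \<Rightarrow> real^'d^'N) \<Rightarrow> (real \<Rightarrow> real^'d^'N) \<Rightarrow> bool) \<Rightarrow> bool" where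
  "has_unique_nbody_solution m p T0 Q \<longleftrightarrow>
     (\<exists>\<alpha> \<beta>. nbody_solution m p T0 \<alpha> \<beta> \<and> Q \<alpha> \<beta> \<and>
        (\<forall>\<alpha>' \<beta>'. nbody_solution m p T0 \<alpha>' \<beta>' \<and> Q \<alpha>' \<beta>' \<longrightarrow>
           (\<forall>t>T0. \<alpha>' t = \<alpha> t \<and> \<beta>' t = \<beta> t)))"

end

theory Submission
  imports Defs
begin

text \<open>The force \<open>F\<close> is homogeneous of degree \<open>-p-1\<close>, so with \<open>s = t powr (-p)\<close> one has
  \<open>F (t a) = t powr (-p-1) F a\<close>, and along \<open>a = v + \<Sum> s ^ k c k\<close> each component of \<open>F\<close> has a Taylor
  expansion in \<open>s\<close>. Matching the coefficient of \<open>s ^ (k-1)\<close> with the second derivative of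
  \<open>c k t powr (1-kp)\<close> determines \<open>c k\<close> from its predecessors, as \<open>(1-kp)(-kp) \<noteq> 0\<close>; at the resonance
  \<open>(n+1)p = 1\<close> the next term is logarithmic. The free motion \<open>x\<close> only enters at relative order \<open>1/t\<close>.
  The remainder \<open>r\<close> solves \<open>r'' = F (A + r) - A''\<close> with \<open>r, r' \<rightarrow> 0\<close>; as \<open>F\<close> has Lipschitz constant
  \<open>O(t powr (-p-2))\<close> near \<open>t v\<close>, integrating twice from infinity is a contraction on a half-line
  \<open>t \<ge> T\<close> with \<open>T\<close> large. Uniqueness near infinity follows from the same estimate and is continued
  backwards to \<open>T\<close> by the local Lipschitz property.\<close>

subsection \<open>The force field\<close>

text \<open>Both cases run through one existence and uniqueness result with an abstract weight
  \<open>h\<close>. It asks for a defect O(h t^-2) and for decay of \<open>h\<close> by at least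
  some power \<eta>; this covers t^(1-(n+1)p) as well as t^(-p) ln t, so the logarithm never has to
  be integrated. The fixed point is sought in the plain supremum norm, inside the set |r| <= K h.
  Invariance of this set uses \<eta> and the defect, contraction uses the exponent p in the
  Lipschitz constant, and closedness is immediate because evaluation is continuous. The Taylor
  expansion is one-dimensional: along a path polynomial in s the squared mutual distances are
  polynomials in s, positive at s = 0, so the binomial series for their real powers is all that has
  to be expanded. Adding s^k c_k to the path changes F only from order s^k on, one order beyond the
  coefficient that c_k is chosen to match; hence earlier coefficients are never revisited.\<close>

text \<open>Despite the name this is an acceleration: the factor \<open>m i\<close> common to both
  sides of the i-th equation is divided out.\<close>

definition force :: "('N::finite \<Rightarrow> real) \<Rightarrow> real \<Rightarrow> real^'d^'N \<Rightarrow> real^'d^'N" where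
  "force m p a = (\<chi> i. - (\<Sum>j\<in>UNIV - {i}. (m j / norm (a $ i - a $ j) powr (p + 2)) *\<^sub>R (a $ i - a $ j)))"

text \<open>The equations of motion are stated body by body, while integration and the fixed point
  live in the whole configuration space. Limits of vectors are componentwise, which links the
  two.\<close>

lemma has_vector_derivative_vec_iff:
  fixes f :: "real \<Rightarrow> ('a::real_normed_vector)^'n"
  shows "(f has_vector_derivative f') (at t within S) \<longleftrightarrow>
    (\<forall>i. ((\<lambda>s. f s $ i) has_vector_derivative f' $ i) (at t within S))"
proof
  assume "(f has_vector_derivative f') (at t within S)"
  then show "\<forall>i. ((\<lambda>s. f s $ i) has_vector_derivative f' $ i) (at t within S)"
    using bounded_linear.has_vector_derivative[OF bounded_linear_vec_nth] by blast
next
  assume "\<forall>i. ((\<lambda>s. f s $ i) has_vector_derivative f' $ i) (at t within S)"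
  then have "((\<lambda>y. (f y - (f t + (y - t) *\<^sub>R f')) /\<^sub>R norm (y - t)) \<longlongrightarrow> 0) (at t within S)"
    by (intro vec_tendstoI) (simp add: has_vector_derivative_def has_derivative_within divide_inverse_commute)
  then show "(f has_vector_derivative f') (at t within S)"
    by (simp add: has_vector_derivative_def has_derivative_within bounded_linear_scaleR_left
        divide_inverse_commute)
qed

lemma nbody_solution_iff_force:
  assumes "\<And>i. m i > 0"
  shows "nbody_solution m p T0 \<alpha> \<beta> \<longleftrightarrow>
    (\<forall>t>T0. \<alpha> t \<in> collision_free \<and> (\<alpha> has_vector_derivative \<beta> t) (at t) \<and>
      (\<beta> has_vector_derivative force m p (\<alpha> t)) (at t))"
proof -
  have eq: "m i *\<^sub>R b = - (\<Sum>j\<in>UNIV - {i}. (m i * m j / norm (a $ i - a $ j) powr (p + 2)) *\<^sub>R (a $ i - a $ j))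
    \<longleftrightarrow> b = force m p a $ i" (is "?l = ?r \<longleftrightarrow> _") for i and b :: "real^'d" and a :: "real^'d^'a"
  proof -
    have "?r = m i *\<^sub>R (force m p a $ i)"
      by (simp add: force_def scaleR_sum_right)
    with assms[of i] show ?thesis by simp
  qed
  show ?thesis
    unfolding nbody_solution_def eq has_vector_derivative_vec_iff by auto
qed

section \<open>Lipschitz estimate and homogeneity of the interaction\<close>

text \<open>Mean value theorem: the slope of s^(-q) has modulus q s^(-q-1), which is largest at the
  left end.\<close>

lemma powr_neg_diff_le:
  fixes x y q :: real
  assumes "0 < x" "x \<le> y" "0 < q"
  shows "x powr (-q) - y powr (-q) \<le> q * x powr (-q - 1) * (y - x)"
proof (cases "x = y")
  case False
  then have "x < y" using assms by simp
  have "DERIV (\<lambda>s. s powr (-q)) s :> -q * s powr (-q - 1)" if "x \<le> s" for s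
    using that assms by (auto intro!: derivative_eq_intros)
  then obtain z where z: "x < z" "z < y" "y powr (-q) - x powr (-q) = (y - x) * (-q * z powr (-q - 1))"
    using MVT2[OF \<open>x < y\<close>, of "\<lambda>s. s powr (-q)" "\<lambda>s. -q * s powr (-q - 1)"] by blast
  have "z powr (-q - 1) \<le> x powr (-q - 1)"
    using z assms by (intro powr_mono2') auto
  then have "q * (y - x) * z powr (-q - 1) \<le> q * (y - x) * x powr (-q - 1)"
    using assms by (intro mult_left_mono) auto
  then show ?thesis using z(3) by (simp add: algebra_simps)
qed simp

text \<open>The point of the global form is that no segment joining \<open>z\<close> and \<open>w\<close> has to avoid the origin.\<close>

lemma scaled_power_lipschitz:
  fixes z w :: "'a::real_normed_vector"
  assumes "0 < \<delta>" "\<delta> \<le> norm z" "\<delta> \<le> norm w" "0 < q"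
  shows "norm ((1 / norm z powr q) *\<^sub>R z - (1 / norm w powr q) *\<^sub>R w)
    \<le> (q + 1) * \<delta> powr (-q) * norm (z - w)"
proof -
  have main: "norm ((1 / norm z powr q) *\<^sub>R z - (1 / norm w powr q) *\<^sub>R w)
    \<le> (q + 1) * \<delta> powr (-q) * norm (z - w)"
    if le: "norm w \<le> norm z" and w: "\<delta> \<le> norm w" for z w :: 'a
  proof -
    have w0: "0 < norm w" using w assms(1) by linarith
    have ez: "(1 / norm z powr q) = norm z powr (-q)" "(1 / norm w powr q) = norm w powr (-q)"
      by (simp_all add: powr_minus_divide)
    have dec: "norm z powr (-q) \<le> norm w powr (-q)"
      using le w0 assms by (intro powr_mono2') auto
    have wd: "norm w powr (-q) \<le> \<delta> powr (-q)"
      using w assms by (intro powr_mono2') auto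
    \<comment> \<open>The splitting puts the difference of the weights on the shorter vector
      \<open>w\<close>: the factor |w|^(-q-1) from the mean value bound then meets |w| and leaves
      |w|^(-q).\<close>
    have "norm (norm z powr (-q) *\<^sub>R z - norm w powr (-q) *\<^sub>R w)
      = norm (norm z powr (-q) *\<^sub>R (z - w) - (norm w powr (-q) - norm z powr (-q)) *\<^sub>R w)"
      by (simp add: algebra_simps)
    also have "\<dots> \<le> norm z powr (-q) * norm (z - w) + (norm w powr (-q) - norm z powr (-q)) * norm w"
      by (rule order_trans[OF norm_triangle_ineq4]) (use dec in simp)
    also have "\<dots> \<le> norm w powr (-q) * norm (z - w) + q * norm w powr (-q - 1) * (norm z - norm w) * norm w"
      using dec powr_neg_diff_le[OF w0 le assms(4)] by (intro add_mono mult_right_mono) auto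
    also have "q * norm w powr (-q - 1) * (norm z - norm w) * norm w
      = q * norm w powr (-q) * (norm z - norm w)"
      using w0 by (simp add: powr_diff)
    also have "\<dots> \<le> q * norm w powr (-q) * norm (z - w)"
      using assms norm_triangle_ineq2[of z w] by (intro mult_left_mono) auto
    also have "norm w powr (-q) * norm (z - w) + q * norm w powr (-q) * norm (z - w)
      = (q + 1) * norm (z - w) * norm w powr (-q)" by (simp add: algebra_simps)
    also have "\<dots> \<le> (q + 1) * norm (z - w) * \<delta> powr (-q)"
      using wd assms by (intro mult_left_mono) auto
    finally show ?thesis unfolding ez by (simp add: mult_ac)
  qed
  show ?thesis
  proof (cases "norm w \<le> norm z")
    case False
    then show ?thesis using main[of z w] assms by (simp add: norm_minus_commute)
  qed (use main assms in auto)
qed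

lemma norm_vec_le_sum: "norm (x :: ('a::real_normed_vector)^'n) \<le> (\<Sum>i\<in>UNIV. norm (x $ i))"
  unfolding norm_vec_def by (rule L2_set_le_sum) simp

lemma norm_component_diff_le:
  fixes a :: "('a::real_normed_vector)^'n"
  shows "norm (a $ i - a $ j) \<le> 2 * norm a"
  using norm_triangle_ineq4[of "a $ i" "a $ j"] Finite_Cartesian_Product.norm_nth_le[of a i]
    Finite_Cartesian_Product.norm_nth_le[of a j] by linarith

text \<open>One \<open>L\<close> serves every separation \<delta>, so that \<delta> may later grow
  linearly in time. Each summand is handled by the global estimate for z / |z|^(p+2), hence
  \<open>a\<close> and \<open>b\<close> may be far from each other.\<close>

lemma force_lipschitz:
  fixes m :: "'N::finite \<Rightarrow> real"
  assumes m: "\<And>i. m i > 0" and p: "p > 0"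
  shows "\<exists>L>0. \<forall>\<delta> (a :: real^'d^'N) b. \<delta> > 0 \<longrightarrow>
      (\<forall>i j. i \<noteq> j \<longrightarrow> \<delta> \<le> norm (a $ i - a $ j) \<and> \<delta> \<le> norm (b $ i - b $ j)) \<longrightarrow>
      norm (force m p a - force m p b) \<le> L * \<delta> powr (-(p + 2)) * norm (a - b)"
proof (intro exI conjI allI impI)
  \<comment> \<open>Here p + 3 is q + 1 for the exponent q = p + 2, and 2 comes from passing from
    pair differences to the full norm. The additional 1 makes \<open>L\<close> strictly
    positive.\<close>
  define L where "L = 1 + (\<Sum>i\<in>(UNIV::'N set). \<Sum>j\<in>UNIV - {i}. m j * (p + 3) * 2)"
  have L0: "0 \<le> (\<Sum>i\<in>(UNIV::'N set). \<Sum>j\<in>UNIV - {i}. m j * (p + 3) * 2)"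
    using m p by (intro sum_nonneg) (auto intro!: mult_nonneg_nonneg less_imp_le)
  then show "L > 0" unfolding L_def by linarith
  fix \<delta> :: real and a b :: "real^'d^'N"
  assume \<delta>: "\<delta> > 0"
    and "\<forall>i j. i \<noteq> j \<longrightarrow> \<delta> \<le> norm (a $ i - a $ j) \<and> \<delta> \<le> norm (b $ i - b $ j)"
  then have a: "\<And>i j. i \<noteq> j \<Longrightarrow> \<delta> \<le> norm (a $ i - a $ j)"
    and b: "\<And>i j. i \<noteq> j \<Longrightarrow> \<delta> \<le> norm (b $ i - b $ j)" by blast+
  let ?k = "\<lambda>z::real^'d. (1 / norm z powr (p + 2)) *\<^sub>R z"
  have summand: "norm (m j *\<^sub>R (?k (a $ i - a $ j) - ?k (b $ i - b $ j)))
      \<le> m j * (p + 3) * 2 * (\<delta> powr (-(p + 2)) * norm (a - b))" if "i \<noteq> j" for i j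
  proof -
    have "norm (m j *\<^sub>R (?k (a $ i - a $ j) - ?k (b $ i - b $ j)))
        = m j * norm (?k (a $ i - a $ j) - ?k (b $ i - b $ j))"
      using m[of j] by simp
    also have "\<dots> \<le> m j * (((p + 2) + 1) * \<delta> powr (-(p + 2)) * norm ((a $ i - a $ j) - (b $ i - b $ j)))"
      using m[of j] \<delta> a[OF that] b[OF that] p
      by (intro mult_left_mono scaled_power_lipschitz) auto
    also have "\<dots> \<le> m j * (((p + 2) + 1) * \<delta> powr (-(p + 2)) * (2 * norm (a - b)))"
    proof -
      have "norm ((a $ i - a $ j) - (b $ i - b $ j)) \<le> 2 * norm (a - b)"
        using norm_component_diff_le[of "a - b" i j] by (simp add: algebra_simps)
      then show ?thesis using m[of j] p by (intro mult_left_mono) auto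
    qed
    finally show ?thesis by (simp add: algebra_simps)
  qed
  have "norm (force m p a - force m p b) \<le> (\<Sum>i\<in>UNIV. norm ((force m p a - force m p b) $ i))"
    by (rule norm_vec_le_sum)
  also have "\<dots> \<le> (\<Sum>i\<in>(UNIV::'N set). \<Sum>j\<in>UNIV - {i}. m j * (p + 3) * 2 * (\<delta> powr (-(p + 2)) * norm (a - b)))"
  proof (rule sum_mono)
    fix i
    have "(force m p a - force m p b) $ i
        = - (\<Sum>j\<in>UNIV - {i}. m j *\<^sub>R (?k (a $ i - a $ j) - ?k (b $ i - b $ j)))"
      by (simp add: force_def sum_subtractf scaleR_diff_right)
    then have "norm ((force m p a - force m p b) $ i)
        = norm (\<Sum>j\<in>UNIV - {i}. m j *\<^sub>R (?k (a $ i - a $ j) - ?k (b $ i - b $ j)))"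
      by (simp only: norm_minus_cancel)
    also have "\<dots> \<le> (\<Sum>j\<in>UNIV - {i}. m j * (p + 3) * 2 * (\<delta> powr (-(p + 2)) * norm (a - b)))"
      by (rule order_trans[OF norm_sum sum_mono]) (use summand in auto)
    finally show "norm ((force m p a - force m p b) $ i)
      \<le> (\<Sum>j\<in>UNIV - {i}. m j * (p + 3) * 2 * (\<delta> powr (-(p + 2)) * norm (a - b)))" .
  qed
  also have "\<dots> = (L - 1) * (\<delta> powr (-(p + 2)) * norm (a - b))"
    by (simp add: L_def sum_distrib_right)
  also have "\<dots> \<le> L * (\<delta> powr (-(p + 2)) * norm (a - b))"
    by (intro mult_right_mono) auto
  finally show "norm (force m p a - force m p b) \<le> L * \<delta> powr (-(p + 2)) * norm (a - b)"
    by (simp add: mult_ac)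
qed

lemma force_scaleR:
  assumes "t > 0"
  shows "force m p (t *\<^sub>R a) = t powr (-p - 1) *\<^sub>R force m p a"
proof -
  have k: "(m j / norm (t *\<^sub>R z) powr (p + 2)) *\<^sub>R (t *\<^sub>R z)
      = t powr (-p - 1) *\<^sub>R ((m j / norm z powr (p + 2)) *\<^sub>R z)" for j and z :: "real^'d"
  proof -
    have "m j / norm (t *\<^sub>R z) powr (p + 2) * t = t powr (-p - 1) * (m j / norm z powr (p + 2))"
      using assms by (simp add: powr_mult powr_add powr_minus powr_diff field_simps power2_eq_square)
    then show ?thesis by (simp only: scaleR_scaleR)
  qed
  have "force m p (t *\<^sub>R a) $ i = (t powr (-p - 1) *\<^sub>R force m p a) $ i" for i
  proof -
    have "force m p (t *\<^sub>R a) $ i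
        = - (\<Sum>j\<in>UNIV - {i}. (m j / norm (t *\<^sub>R (a $ i - a $ j)) powr (p + 2)) *\<^sub>R (t *\<^sub>R (a $ i - a $ j)))"
      by (simp only: force_def vec_lambda_beta vector_scaleR_component scaleR_diff_right)
    also have "\<dots> = (t powr (-p - 1) *\<^sub>R force m p a) $ i"
      unfolding k by (simp add: force_def scaleR_sum_right)
    finally show ?thesis .
  qed
  then show ?thesis by (simp add: vec_eq_iff)
qed

text \<open>The constants in the tail estimates carry no sign assumption; one instance of the bound
  supplies the sign.\<close>

lemma nonneg_of_norm_le_powr:
  assumes "norm x \<le> K * t powr e" "t > 0"
  shows "K \<ge> 0"
proof -
  have "0 \<le> K * t powr e" using assms(1) norm_ge_zero order_trans by blast
  then show ?thesis using assms(2) by (simp add: zero_le_mult_iff)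
qed

subsection \<open>Integrating decaying functions from infinity\<close>

lemma increment_norm_bound:
  fixes D :: "real \<Rightarrow> 'a::real_normed_vector"
  assumes "\<eta> > 0" "T > 0"
    and D: "\<And>u. u \<ge> T \<Longrightarrow> (D has_vector_derivative D' u) (at u within {T..})"
    and D': "\<And>u. u \<ge> T \<Longrightarrow> norm (D' u) \<le> K * u powr (-1 - \<eta>)"
    and "T \<le> a" "a \<le> b"
  shows "norm (D b - D a) \<le> K / \<eta> * a powr (-\<eta>)"
proof -
  define \<phi> where "\<phi> = (\<lambda>u. - (K / \<eta>) * u powr (-\<eta>))"
  have K: "K \<ge> 0"
    using nonneg_of_norm_le_powr[OF D'[OF order.refl] assms(2)] .
  show ?thesis
  proof (cases "a = b")
    case True
    then show ?thesis using K assms(1) by simp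
  next
    case False
    then have "a < b" using assms(6) by simp
    have "norm (D b - D a) \<le> \<phi> b - \<phi> a"
    proof (rule differentiable_bound_general[OF \<open>a < b\<close>, where \<phi>' = "\<lambda>u. K * u powr (-1 - \<eta>)"])
      have "continuous_on {T..} D"
        unfolding continuous_on_eq_continuous_within
        using has_vector_derivative_continuous[OF D] by simp
      then show "continuous_on {a..b} D" by (rule continuous_on_subset) (use assms(5) in auto)
      show "continuous_on {a..b} \<phi>"
        unfolding \<phi>_def using assms(1,2,5)
        by (intro continuous_on_mult_left continuous_on_powr continuous_on_id continuous_on_const) auto
      fix u assume u: "a < u" "u < b"
      show "(D has_vector_derivative D' u) (at u)"
        using D[of u] u assms(5) at_within_interior[of u "{T..}"] by simp
      have "(\<phi> has_real_derivative K * u powr (-\<eta> - 1)) (at u)"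
        unfolding \<phi>_def using u assms(1,2,5)
        by (auto intro!: derivative_eq_intros)
      moreover have "-\<eta> - 1 = -1 - \<eta>" by simp
      ultimately have "(\<phi> has_real_derivative K * u powr (-1 - \<eta>)) (at u)"
        by simp
      then show "(\<phi> has_vector_derivative K * u powr (-1 - \<eta>)) (at u)"
        by (rule has_real_derivative_iff_has_vector_derivative[THEN iffD1])
      show "norm (D' u) \<le> K * u powr (-1 - \<eta>)" using D'[of u] u assms(5) by simp
    qed
    also have "\<dots> \<le> - \<phi> a" unfolding \<phi>_def using K assms(1) by simp
    finally show ?thesis by (simp add: \<phi>_def)
  qed
qed

text \<open>The increment bound does not depend on its right end point, which can therefore be sent
  to infinity, where \<open>D\<close> vanishes.\<close>

lemma tail_norm_bound:
  fixes D :: "real \<Rightarrow> 'a::real_normed_vector"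
  assumes "\<eta> > 0" "t > 0"
    and D: "\<And>u. u \<ge> t \<Longrightarrow> (D has_vector_derivative D' u) (at u within {t..})"
    and D': "\<And>u. u \<ge> t \<Longrightarrow> norm (D' u) \<le> K * u powr (-1 - \<eta>)"
    and lim: "(D \<longlongrightarrow> 0) at_top"
  shows "norm (D t) \<le> K / \<eta> * t powr (-\<eta>)"
proof -
  have "norm (D b - D t) \<le> K / \<eta> * t powr (-\<eta>)" if "b \<ge> t" for b
    by (rule increment_norm_bound[OF assms(1,2) D D']) (use that in auto)
  then have "\<forall>\<^sub>F b in at_top. norm (D b - D t) \<le> K / \<eta> * t powr (-\<eta>)"
    by (rule eventually_mono[OF eventually_ge_at_top])
  moreover have "((\<lambda>b. norm (D b - D t)) \<longlongrightarrow> norm (0 - D t)) at_top"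
    by (intro tendsto_intros lim)
  ultimately show ?thesis
    using tendsto_upperbound[OF _ _ trivial_limit_at_top_linorder] by fastforce
qed

lemma tail_exists:
  fixes g :: "real \<Rightarrow> 'a::banach"
  assumes "\<eta> > 0" "T > 0"
    and g: "continuous_on {T..} g"
    and bound: "\<And>u. u \<ge> T \<Longrightarrow> norm (g u) \<le> K * u powr (-1 - \<eta>)"
  obtains R where "\<And>u. u \<ge> T \<Longrightarrow> (R has_vector_derivative g u) (at u within {T..})"
    "(R \<longlongrightarrow> 0) at_top"
proof -
  \<comment> \<open>Subtracting the limit of this primitive at infinity produces minus the integral
    from t to infinity.\<close>
  define G where "G = (\<lambda>t. integral {T..t} g)"
  have G: "(G has_vector_derivative g u) (at u within {T..})" if "u \<ge> T" for u
  proof -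
    have "(G has_vector_derivative g u) (at u within {T..u+1})"
      unfolding G_def using that
      by (intro integral_has_vector_derivative continuous_on_subset[OF g]) auto
    moreover have "at u within {T..u+1} = at u within {T..}"
      by (rule at_within_nhd[of _ "{..<u+1}"]) auto
    ultimately show ?thesis by simp
  qed
  have diff: "norm (G b - G a) \<le> K / \<eta> * a powr (-\<eta>)" if "T \<le> a" "a \<le> b" for a b
    by (rule increment_norm_bound[OF assms(1,2) G bound]) (use that in auto)
  have small: "((\<lambda>a. K / \<eta> * a powr (-\<eta>)) \<longlongrightarrow> 0) at_top"
    using assms(1) by (intro tendsto_mult_right_zero tendsto_neg_powr filterlim_ident) auto
  \<comment> \<open>Completeness is applied along integer steps from \<open>T\<close>; the increment
    bound afterwards carries the limit over to all real times.\<close>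
  have "Cauchy (\<lambda>k. G (T + real k))"
  proof (rule metric_CauchyI)
    fix e :: real assume "e > 0"
    have "filterlim (\<lambda>k. T + real k) at_top sequentially"
      by (intro filterlim_tendsto_add_at_top[OF tendsto_const] filterlim_real_sequentially)
    then have "((\<lambda>k. K / \<eta> * (T + real k) powr (-\<eta>)) \<longlongrightarrow> 0) sequentially"
      by (rule filterlim_compose[OF small])
    then have "\<forall>\<^sub>F k in sequentially. K / \<eta> * (T + real k) powr (-\<eta>) < e / 2"
      by (rule order_tendstoD(2)) (use \<open>e > 0\<close> in simp)
    then obtain M where M: "K / \<eta> * (T + real M) powr (-\<eta>) < e / 2"
      by (auto simp: eventually_sequentially)
    have near: "dist (G (T + real k)) (G (T + real M)) < e / 2" if "k \<ge> M" for k
      using diff[of "T + real M" "T + real k"] that M unfolding dist_norm by linarith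
    show "\<exists>M. \<forall>i\<ge>M. \<forall>j\<ge>M. dist (G (T + real i)) (G (T + real j)) < e"
      by (intro exI[of _ M] allI impI dist_triangle_half_l[OF near near])
  qed
  then obtain L where L: "(\<lambda>k. G (T + real k)) \<longlonglongrightarrow> L"
    using Cauchy_convergent_iff convergent_def by blast
  have GL: "norm (G t - L) \<le> K / \<eta> * t powr (-\<eta>)" if "t \<ge> T" for t
  proof -
    have "\<forall>\<^sub>F k in sequentially. norm (G (T + real k) - G t) \<le> K / \<eta> * t powr (-\<eta>)"
      using eventually_ge_at_top[of "nat \<lceil>t - T\<rceil>"]
    proof eventually_elim
      case (elim k)
      then have "t \<le> T + real k" by linarith
      then show ?case using diff[OF that] by simp
    qed
    moreover have "(\<lambda>k. norm (G (T + real k) - G t)) \<longlonglongrightarrow> norm (L - G t)"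
      by (intro tendsto_intros L)
    ultimately have "norm (L - G t) \<le> K / \<eta> * t powr (-\<eta>)"
      using tendsto_upperbound[OF _ _ sequentially_bot] by fastforce
    then show ?thesis by (simp add: norm_minus_commute)
  qed
  show thesis
  proof
    show "((\<lambda>t. G t - L) has_vector_derivative g u) (at u within {T..})" if "u \<ge> T" for u
      using G[OF that] by (auto intro!: derivative_eq_intros)
    show "((\<lambda>t. G t - L) \<longlongrightarrow> 0) at_top"
      using GL by (intro Lim_null_comparison[OF eventually_mono[OF eventually_ge_at_top[of T]] small])
  qed
qed

text \<open>Each integration from infinity raises the exponent by one. The first has the constant K
  / (1 + \<eta>), relaxed to K, and the second contributes the factor 1 / \<eta>.\<close>

lemma double_tail_bound:
  fixes Y Z :: "real \<Rightarrow> 'a::real_normed_vector"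
  assumes "\<eta> > 0" "t > 0"
    and Y: "\<And>u. u \<ge> t \<Longrightarrow> (Y has_vector_derivative Z u) (at u within {t..})"
    and Z: "\<And>u. u \<ge> t \<Longrightarrow> (Z has_vector_derivative g u) (at u within {t..})"
    and g: "\<And>u. u \<ge> t \<Longrightarrow> norm (g u) \<le> K * u powr (-2 - \<eta>)"
    and lim: "(Y \<longlongrightarrow> 0) at_top" "(Z \<longlongrightarrow> 0) at_top"
  shows "norm (Z t) \<le> K * t powr (-1 - \<eta>)" "norm (Y t) \<le> K / \<eta> * t powr (-\<eta>)"
proof -
  have K: "K \<ge> 0"
    using nonneg_of_norm_le_powr[OF g[OF order.refl] assms(2)] .
  have Zb: "norm (Z u) \<le> K * u powr (-1 - \<eta>)" if "u \<ge> t" for u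
  proof -
    have "norm (Z u) \<le> K / (1 + \<eta>) * u powr (- (1 + \<eta>))"
    proof (rule tail_norm_bound[where D' = g])
      show "(Z has_vector_derivative g s) (at s within {u..})" if "s \<ge> u" for s
        using Z[of s] by (rule has_vector_derivative_within_subset) (use that \<open>u \<ge> t\<close> in auto)
      show "norm (g s) \<le> K * s powr (-1 - (1 + \<eta>))" if "s \<ge> u" for s
        using g[of s] that \<open>u \<ge> t\<close> by simp
    qed (use assms(1,2) that lim in auto)
    also have "\<dots> \<le> K * u powr (- (1 + \<eta>))"
      using K assms(1) by (intro mult_right_mono) (auto simp: field_simps)
    finally show ?thesis by simp
  qed
  then show "norm (Z t) \<le> K * t powr (-1 - \<eta>)" by simp
  show "norm (Y t) \<le> K / \<eta> * t powr (-\<eta>)"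
    by (rule tail_norm_bound[OF assms(1,2) Y Zb lim(1)])
qed

lemma double_tail_exists:
  fixes g :: "real \<Rightarrow> 'a::banach"
  assumes "\<eta> > 0" "T > 0"
    and g: "continuous_on {T..} g"
    and bound: "\<And>u. u \<ge> T \<Longrightarrow> norm (g u) \<le> K * u powr (-2 - \<eta>)"
  obtains Y Z where "\<And>u. u \<ge> T \<Longrightarrow> (Y has_vector_derivative Z u) (at u within {T..})"
    "\<And>u. u \<ge> T \<Longrightarrow> (Z has_vector_derivative g u) (at u within {T..})"
    "(Y \<longlongrightarrow> 0) at_top" "(Z \<longlongrightarrow> 0) at_top"
proof -
  obtain Z where Z: "\<And>u. u \<ge> T \<Longrightarrow> (Z has_vector_derivative g u) (at u within {T..})"
    "(Z \<longlongrightarrow> 0) at_top"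
  proof (rule tail_exists[OF _ assms(2) g])
    show "0 < 1 + \<eta>" using assms(1) by simp
    show "norm (g u) \<le> K * u powr (-1 - (1 + \<eta>))" if "T \<le> u" for u
      using bound[OF that] by simp
  qed (rule that)
  have Zb: "norm (Z u) \<le> K / (1 + \<eta>) * u powr (- 1 - \<eta>)" if "u \<ge> T" for u
  proof -
    have "norm (Z u) \<le> K / (1 + \<eta>) * u powr (- (1 + \<eta>))"
    proof (rule tail_norm_bound[where D' = g])
      show "(Z has_vector_derivative g s) (at s within {u..})" if "s \<ge> u" for s
        using Z(1)[of s] by (rule has_vector_derivative_within_subset) (use that \<open>u \<ge> T\<close> in auto)
      show "norm (g s) \<le> K * s powr (-1 - (1 + \<eta>))" if "s \<ge> u" for s
        using bound[of s] that \<open>u \<ge> T\<close> by simp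
    qed (use assms(1,2) that Z(2) in auto)
    then show ?thesis by simp
  qed
  have cont: "continuous_on {T..} Z"
    unfolding continuous_on_eq_continuous_within
    using has_vector_derivative_continuous[OF Z(1)] by simp
  obtain Y where Y: "\<And>u. u \<ge> T \<Longrightarrow> (Y has_vector_derivative Z u) (at u within {T..})"
    "(Y \<longlongrightarrow> 0) at_top"
    by (rule tail_exists[OF assms(1,2) cont Zb]) (assumption, rule that)
  show thesis by (rule that[OF Y(1) Z(1) Y(2) Z(2)])
qed

subsection \<open>Geometry of the collision-free set and uniqueness\<close>

text \<open>Each \<open>P i\<close> holds for all sufficiently small positive \<delta>, and finitely
  many such conditions hold simultaneously. The index type will be the pairs of bodies.\<close>

lemma finite_uniform_lower_bound:
  fixes P :: "'a::finite \<Rightarrow> real \<Rightarrow> bool"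
  assumes "\<And>i. \<exists>\<delta>>0. P i \<delta>" and "\<And>i \<delta> \<delta>'. P i \<delta> \<Longrightarrow> \<delta>' \<le> \<delta> \<Longrightarrow> P i \<delta>'"
  shows "\<exists>\<delta>>0. \<forall>i. P i \<delta>"
proof -
  have "\<forall>\<^sub>F \<delta> in at_right 0. P i \<delta>" for i
  proof -
    obtain \<delta> where "\<delta> > 0" "P i \<delta>" using assms(1) by blast
    then show ?thesis
      using assms(2) by (auto simp: eventually_at_right_field intro!: exI[of _ \<delta>])
  qed
  then have "\<forall>\<^sub>F \<delta> in at_right 0. 0 < \<delta> \<and> (\<forall>i. P i \<delta>)"
    by (intro eventually_conj eventually_all_finite eventually_at_right_less)
  then show ?thesis
    using eventually_happens trivial_limit_at_right_real by blast
qed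

lemma cone_separation:
  fixes v :: "real^'d^'N"
  assumes "v \<in> collision_free"
  obtains \<delta> where "\<delta> > 0"
    "\<And>t a i j. t > 0 \<Longrightarrow> norm (a - t *\<^sub>R v) \<le> \<delta> * t \<Longrightarrow> i \<noteq> j \<Longrightarrow> \<delta> * t \<le> norm (a $ i - a $ j)"
proof -
  \<comment> \<open>A third of the smallest gap: bodies of t v are at least 3 \<delta> t apart, a
    perturbation of size \<delta> t costs at most 2 \<delta> t, and \<delta> t remains.\<close>
  have "\<exists>\<delta>>0. fst ij \<noteq> snd ij \<longrightarrow> 3 * \<delta> \<le> norm (v $ fst ij - v $ snd ij)" for ij :: "'N \<times> 'N"
  proof (cases "fst ij = snd ij")
    case False
    then have "norm (v $ fst ij - v $ snd ij) > 0"
      using assms by (auto simp: collision_free_def)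
    then show ?thesis by (intro exI[of _ "norm (v $ fst ij - v $ snd ij) / 3"]) auto
  qed (auto intro: exI[of _ 1])
  then have "\<exists>\<delta>>0. \<forall>ij :: 'N \<times> 'N. fst ij \<noteq> snd ij \<longrightarrow> 3 * \<delta> \<le> norm (v $ fst ij - v $ snd ij)"
    by (rule finite_uniform_lower_bound) auto
  then obtain \<delta> where \<delta>: "\<delta> > 0"
    "\<And>ij :: 'N \<times> 'N. fst ij \<noteq> snd ij \<longrightarrow> 3 * \<delta> \<le> norm (v $ fst ij - v $ snd ij)"
    by blast
  show thesis
  proof
    fix t :: real and a and i j :: 'N
    assume t: "t > 0" and a: "norm (a - t *\<^sub>R v) \<le> \<delta> * t" and ij: "i \<noteq> j"
    have "t * (3 * \<delta>) \<le> t * norm (v $ i - v $ j)"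
      using \<delta>(2)[of "(i, j)"] ij t by (intro mult_left_mono) auto
    also have "\<dots> = norm ((a $ i - a $ j) - ((a - t *\<^sub>R v) $ i - (a - t *\<^sub>R v) $ j))"
      using t by (simp flip: scaleR_diff_right)
    also have "\<dots> \<le> norm (a $ i - a $ j) + 2 * norm (a - t *\<^sub>R v)"
      using norm_component_diff_le[of "a - t *\<^sub>R v" i j] norm_triangle_ineq4 order_trans
      by (smt (verit, best))
    finally show "\<delta> * t \<le> norm (a $ i - a $ j)" using a by (simp add: algebra_simps)
  qed (fact \<delta>)
qed

text \<open>Inside the cone around t v the bodies are \<delta> t apart; inserting this separation
  into \<open>force_lipschitz\<close> yields the factor t^(-2-p). The same \<delta> is the opening
  of the cone and the rate of separation.\<close>

lemma force_lipschitz_on_cone: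
  fixes m :: "'N::finite \<Rightarrow> real" and v :: "real^'d^'N"
  assumes "\<And>i. m i > 0" "p > 0" "v \<in> collision_free"
  obtains \<delta> L where "\<delta> > 0" "L > 0"
    "\<And>t a. t > 0 \<Longrightarrow> norm (a - t *\<^sub>R v) \<le> \<delta> * t \<Longrightarrow> a \<in> collision_free"
    "\<And>t a b. t > 0 \<Longrightarrow> norm (a - t *\<^sub>R v) \<le> \<delta> * t \<Longrightarrow> norm (b - t *\<^sub>R v) \<le> \<delta> * t \<Longrightarrow>
      norm (force m p a - force m p b) \<le> L * t powr (-2 - p) * norm (a - b)"
proof -
  obtain \<delta> where \<delta>: "\<delta> > 0"
    "\<And>t a i j. t > 0 \<Longrightarrow> norm (a - t *\<^sub>R v) \<le> \<delta> * t \<Longrightarrow> i \<noteq> j \<Longrightarrow> \<delta> * t \<le> norm (a $ i - a $ j)"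
    by (rule cone_separation[OF assms(3)]) (rule that)
  obtain L where L: "L > 0" "\<forall>\<epsilon> (a :: real^'d^'N) b. \<epsilon> > 0 \<longrightarrow>
      (\<forall>i j. i \<noteq> j \<longrightarrow> \<epsilon> \<le> norm (a $ i - a $ j) \<and> \<epsilon> \<le> norm (b $ i - b $ j)) \<longrightarrow>
      norm (force m p a - force m p b) \<le> L * \<epsilon> powr (-(p + 2)) * norm (a - b)"
    using force_lipschitz[of m p, OF assms(1,2)] by blast
  show thesis
  proof (rule that[of \<delta> "L * \<delta> powr (-(p + 2))"])
    show "a \<in> collision_free" if "t > 0" "norm (a - t *\<^sub>R v) \<le> \<delta> * t" for t a
    proof -
      have "0 < norm (a $ i - a $ j)" if "i \<noteq> j" for i j
        using \<delta>(2)[OF \<open>t > 0\<close> \<open>norm (a - t *\<^sub>R v) \<le> \<delta> * t\<close> that]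
          mult_pos_pos[OF \<delta>(1) \<open>t > 0\<close>] by linarith
      then show ?thesis by (auto simp: collision_free_def)
    qed
    show "norm (force m p a - force m p b) \<le> L * \<delta> powr (-(p + 2)) * t powr (-2 - p) * norm (a - b)"
      if "t > 0" "norm (a - t *\<^sub>R v) \<le> \<delta> * t" "norm (b - t *\<^sub>R v) \<le> \<delta> * t" for t a b
    proof -
      have "norm (force m p a - force m p b) \<le> L * (\<delta> * t) powr (-(p + 2)) * norm (a - b)"
        using \<delta>(1) that(1) \<delta>(2)[OF that(1,2)] \<delta>(2)[OF that(1,3)]
        by (intro L(2)[rule_format]) auto
      also have "(\<delta> * t) powr (-(p + 2)) = \<delta> powr (-(p + 2)) * t powr (-2 - p)"
      proof -
        have "-(p + 2) = -2 - p" by simp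
        then show ?thesis using \<delta>(1) that(1) by (simp only: powr_mult)
      qed
      finally show ?thesis by (simp add: mult_ac)
    qed
  qed (use \<delta> L in auto)
qed

lemma continuous_on_force:
  assumes "p > 0"
  shows "continuous_on collision_free (force m p)"
  unfolding force_def
  using assms by (intro continuous_intros) (auto simp: collision_free_def)

lemma nbody_solution_continuous_on:
  assumes "\<And>i. m i > 0" "nbody_solution m p T0 \<alpha> \<beta>"
  shows "continuous_on {T0<..} \<alpha>"
  using assms(2) unfolding nbody_solution_iff_force[of m, OF assms(1)]
  by (auto intro!: continuous_at_imp_continuous_on has_vector_derivative_continuous)

text \<open>Each mutual distance is continuous and positive on a compact interval, so it attains a
  positive minimum, and there are finitely many pairs.\<close>

lemma compact_separation:
  fixes \<alpha> :: "real \<Rightarrow> real^'d^'N"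
  assumes "continuous_on {a..b} \<alpha>" "\<And>t. t \<in> {a..b} \<Longrightarrow> \<alpha> t \<in> collision_free"
  shows "\<exists>\<delta>>0. \<forall>t\<in>{a..b}. \<forall>i j. i \<noteq> j \<longrightarrow> \<delta> \<le> norm (\<alpha> t $ i - \<alpha> t $ j)"
proof -
  have "\<exists>\<delta>>0. \<forall>t\<in>{a..b}. fst ij \<noteq> snd ij \<longrightarrow> \<delta> \<le> norm (\<alpha> t $ fst ij - \<alpha> t $ snd ij)"
    for ij :: "'N \<times> 'N"
  proof (cases "fst ij = snd ij \<or> {a..b} = {}")
    case False
    have cn: "continuous_on {a..b} (\<lambda>t. norm (\<alpha> t $ fst ij - \<alpha> t $ snd ij))"
      by (intro continuous_intros assms(1))
    obtain s where s: "s \<in> {a..b}"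
      "\<And>t. t \<in> {a..b} \<Longrightarrow> norm (\<alpha> s $ fst ij - \<alpha> s $ snd ij) \<le> norm (\<alpha> t $ fst ij - \<alpha> t $ snd ij)"
      using continuous_attains_inf[OF compact_Icc _ cn] False by blast
    moreover have "norm (\<alpha> s $ fst ij - \<alpha> s $ snd ij) > 0"
      using assms(2)[OF s(1)] False by (auto simp: collision_free_def)
    ultimately show ?thesis by blast
  qed (auto intro: exI[of _ 1])
  then have "\<exists>\<delta>>0. \<forall>ij :: 'N \<times> 'N. \<forall>t\<in>{a..b}. fst ij \<noteq> snd ij \<longrightarrow> \<delta> \<le> norm (\<alpha> t $ fst ij - \<alpha> t $ snd ij)"
    by (rule finite_uniform_lower_bound) force
  then show ?thesis by auto
qed

section \<open>Uniqueness on compact intervals and near infinity\<close>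

lemma has_real_derivative_inner_self:
  fixes f :: "real \<Rightarrow> 'a::real_inner"
  assumes "(f has_vector_derivative f') (at t)"
  shows "((\<lambda>s. f s \<bullet> f s) has_real_derivative 2 * (f t \<bullet> f')) (at t)"
  using has_derivative_inner[OF assms[unfolded has_vector_derivative_def] assms[unfolded has_vector_derivative_def]]
  unfolding has_field_derivative_def
  by (rule has_derivative_eq_rhs) (auto simp: inner_commute)

text \<open>With \<open>e\<close> the squared distance in phase space, \<open>e' \<ge> - K e\<close>, so \<open>exp (K t) * e t\<close> is
  nondecreasing.\<close>

lemma nbody_backward_uniqueness:
  fixes \<alpha> \<beta> \<alpha>' \<beta>' :: "real \<Rightarrow> real^'d^'N"
  assumes m: "\<And>i. m i > 0" and p: "p > 0"
    and sol: "nbody_solution m p T0 \<alpha> \<beta>" "nbody_solution m p T0 \<alpha>' \<beta>'"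
    and eq: "\<alpha>' t1 = \<alpha> t1" "\<beta>' t1 = \<beta> t1" and t: "T0 < a" "a \<le> t1"
  shows "\<alpha>' a = \<alpha> a \<and> \<beta>' a = \<beta> a"
proof -
  note solD = sol[unfolded nbody_solution_iff_force[of m, OF m], rule_format]
  have cont: "continuous_on {a..t1} \<alpha>" "continuous_on {a..t1} \<alpha>'"
    using t by (auto intro: continuous_on_subset[OF nbody_solution_continuous_on[of m, OF m sol(1)]]
        continuous_on_subset[OF nbody_solution_continuous_on[of m, OF m sol(2)]])
  have cf: "\<alpha> s \<in> collision_free" "\<alpha>' s \<in> collision_free" if "s \<in> {a..t1}" for s
    using solD[of s] that t by auto
  have "\<exists>\<delta>>0. \<forall>t\<in>{a..t1}. \<forall>i j. i \<noteq> j \<longrightarrow> \<delta> \<le> norm (\<alpha> t $ i - \<alpha> t $ j)"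
    using cont(1) cf(1) by (rule compact_separation)
  then obtain \<delta>1 where \<delta>1: "\<delta>1 > 0" "\<forall>t\<in>{a..t1}. \<forall>i j. i \<noteq> j \<longrightarrow> \<delta>1 \<le> norm (\<alpha> t $ i - \<alpha> t $ j)"
    by (elim exE conjE) (rule that)
  have "\<exists>\<delta>>0. \<forall>t\<in>{a..t1}. \<forall>i j. i \<noteq> j \<longrightarrow> \<delta> \<le> norm (\<alpha>' t $ i - \<alpha>' t $ j)"
    using cont(2) cf(2) by (rule compact_separation)
  then obtain \<delta>2 where \<delta>2: "\<delta>2 > 0" "\<forall>t\<in>{a..t1}. \<forall>i j. i \<noteq> j \<longrightarrow> \<delta>2 \<le> norm (\<alpha>' t $ i - \<alpha>' t $ j)"
    by (elim exE conjE) (rule that)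
  obtain L where L: "L > 0" "\<forall>\<epsilon> (a :: real^'d^'N) b. \<epsilon> > 0 \<longrightarrow>
      (\<forall>i j. i \<noteq> j \<longrightarrow> \<epsilon> \<le> norm (a $ i - a $ j) \<and> \<epsilon> \<le> norm (b $ i - b $ j)) \<longrightarrow>
      norm (force m p a - force m p b) \<le> L * \<epsilon> powr (-(p + 2)) * norm (a - b)"
    using force_lipschitz[of m p, OF m p] by blast
  \<comment> \<open>Each trajectory only has to be separated on its own; the two configurations at a
    given time need not be close, thanks to the global form of the Lipschitz estimate.\<close>
  define M where "M = L * min \<delta>1 \<delta>2 powr (-(p + 2))"
  define D where "D = (\<lambda>t. \<alpha>' t - \<alpha> t)"
  define D' where "D' = (\<lambda>t. \<beta>' t - \<beta> t)"
  define \<Delta> where "\<Delta> = (\<lambda>t. force m p (\<alpha>' t) - force m p (\<alpha> t))"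
  \<comment> \<open>Bounding both products in e' = 2 D.D' + 2 D'.\<Delta> by Young's inequality
    gives e' >= -((1 + M^2) |D|^2 + 2 |D'|^2), and 2 + M^2 dominates both coefficients.\<close>
  define K where "K = 2 + M\<^sup>2"
  define e where "e = (\<lambda>t. D t \<bullet> D t + D' t \<bullet> D' t)"
  have lip: "norm (\<Delta> t) \<le> M * norm (D t)" if "t \<in> {a..t1}" for t
    unfolding \<Delta>_def M_def D_def
    using \<delta>1(1) \<delta>2(1) \<delta>1(2)[rule_format, OF that] \<delta>2(2)[rule_format, OF that]
    by (intro L(2)[rule_format]) (auto simp: min_le_iff_disj)
  have "exp (K * a) * e a \<le> exp (K * t1) * e t1"
  proof (rule DERIV_nonneg_imp_nondecreasing[OF t(2)])
    fix s assume s: "a \<le> s" "s \<le> t1"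
    then have "T0 < s" using t by simp
    then have "(D has_vector_derivative D' s) (at s)" "(D' has_vector_derivative \<Delta> s) (at s)"
      unfolding D_def D'_def \<Delta>_def
      using solD[of s] by (auto intro!: has_vector_derivative_diff)
    then have e': "(e has_real_derivative 2 * (D s \<bullet> D' s) + 2 * (D' s \<bullet> \<Delta> s)) (at s)"
      unfolding e_def by (intro DERIV_add has_real_derivative_inner_self)
    have "- (D s \<bullet> D' s) \<le> norm (D s) * norm (D' s)" "- (D' s \<bullet> \<Delta> s) \<le> norm (D' s) * norm (\<Delta> s)"
      using Cauchy_Schwarz_ineq2[of "D s" "D' s"] Cauchy_Schwarz_ineq2[of "D' s" "\<Delta> s"] by linarith+
    moreover have "norm (D' s) * norm (\<Delta> s) \<le> norm (D' s) * (M * norm (D s))"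
      using lip[of s] s by (intro mult_left_mono) auto
    moreover have "2 * (norm (D s) * norm (D' s)) \<le> (norm (D s))\<^sup>2 + (norm (D' s))\<^sup>2"
      using sum_squares_bound[of "norm (D s)" "norm (D' s)"] by simp
    moreover have "2 * (norm (D' s) * (M * norm (D s))) \<le> (norm (D' s))\<^sup>2 + M\<^sup>2 * (norm (D s))\<^sup>2"
      using sum_squares_bound[of "norm (D' s)" "M * norm (D s)"] by (simp add: power_mult_distrib)
    moreover have "K * e s = 2 * (norm (D s))\<^sup>2 + 2 * (norm (D' s))\<^sup>2 + M\<^sup>2 * (norm (D s))\<^sup>2
        + M\<^sup>2 * (norm (D' s))\<^sup>2"
      by (simp add: K_def e_def power2_norm_eq_inner algebra_simps)
    moreover have "0 \<le> M\<^sup>2 * (norm (D' s))\<^sup>2" "0 \<le> (norm (D s))\<^sup>2" by simp_all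
    ultimately have "0 \<le> K * e s + (2 * (D s \<bullet> D' s) + 2 * (D' s \<bullet> \<Delta> s))"
      by linarith
    then have "0 \<le> exp (K * s) * (K * e s + (2 * (D s \<bullet> D' s) + 2 * (D' s \<bullet> \<Delta> s)))"
      by simp
    moreover have "((\<lambda>s. exp (K * s) * e s) has_real_derivative
        exp (K * s) * (K * e s + (2 * (D s \<bullet> D' s) + 2 * (D' s \<bullet> \<Delta> s)))) (at s)"
      by (rule derivative_eq_intros e' refl | simp)+ (simp add: algebra_simps)
    ultimately show "\<exists>y. ((\<lambda>s. exp (K * s) * e s) has_real_derivative y) (at s) \<and> 0 \<le> y"
      by blast
  qed
  also have "e t1 = 0" by (simp add: e_def D_def D'_def eq)
  finally have "e a \<le> 0" by (simp add: mult_le_0_iff)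
  moreover have "D a \<bullet> D a \<ge> 0" "D' a \<bullet> D' a \<ge> 0" by simp_all
  ultimately have "D a \<bullet> D a = 0" "D' a \<bullet> D' a = 0" unfolding e_def by linarith+
  then show ?thesis by (simp add: D_def D'_def)
qed

text \<open>Integrating twice from infinity bounds |Y| by (L / p) t^(-p) times the supremum of |Y|
  on a half-line. Far out this factor is below 1/2, so the supremum is 0, and the bound for
  \<open>Z\<close> vanishes with it.\<close>

lemma tail_linear_uniqueness:
  fixes Y Z :: "real \<Rightarrow> 'a::real_normed_vector"
  assumes p: "p > 0" and L: "L > 0"
    and Y: "\<And>u. u \<ge> T1 \<Longrightarrow> (Y has_vector_derivative Z u) (at u)"
    and Z: "\<And>u. u \<ge> T1 \<Longrightarrow> (Z has_vector_derivative g u) (at u)"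
    and g: "\<And>u. u \<ge> T1 \<Longrightarrow> norm (g u) \<le> L * u powr (-2 - p) * norm (Y u)"
    and lim: "(Y \<longlongrightarrow> 0) at_top" "(Z \<longlongrightarrow> 0) at_top"
  obtains T where "T \<ge> T1" "\<And>t. t \<ge> T \<Longrightarrow> Y t = 0 \<and> Z t = 0"
proof -
  have "((\<lambda>t. L / p * t powr (-p)) \<longlongrightarrow> 0) at_top"
    using p by (intro tendsto_mult_right_zero tendsto_neg_powr filterlim_ident) auto
  then have "\<forall>\<^sub>F t in at_top. L / p * t powr (-p) < 1 / 2"
    by (rule order_tendstoD(2)) simp
  moreover have "\<forall>\<^sub>F t in at_top. norm (Y t) < 1"
    using tendsto_norm[OF lim(1)] by (rule order_tendstoD(2)) simp
  ultimately have "\<forall>\<^sub>F t in at_top. L / p * t powr (-p) < 1 / 2 \<and> norm (Y t) < 1 \<and> t \<ge> T1 \<and> t > 0"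
    by (intro eventually_conj eventually_ge_at_top eventually_gt_at_top)
  then obtain T where T: "\<And>t. t \<ge> T \<Longrightarrow> L / p * t powr (-p) < 1 / 2 \<and> norm (Y t) < 1 \<and> t \<ge> T1 \<and> t > 0"
    unfolding eventually_at_top_linorder by blast
  \<comment> \<open>Convergence of \<open>Y\<close> to 0 keeps it below 1 beyond \<open>T\<close>,
    which makes this supremum finite.\<close>
  define M where "M = (SUP t\<in>{T..}. norm (Y t))"
  have bdd: "bdd_above ((\<lambda>t. norm (Y t)) ` {T..})"
    using T by (auto intro!: bdd_aboveI[of _ 1] less_imp_le)
  have M: "norm (Y t) \<le> M" if "t \<ge> T" for t
    unfolding M_def using bdd that by (intro cSUP_upper) auto
  have M0: "M \<ge> 0" using M[of T] norm_ge_zero[of "Y T"] by linarith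
  have b: "norm (Z t) \<le> L * M * t powr (-1 - p) \<and> norm (Y t) \<le> L * M / p * t powr (-p)"
    if t: "t \<ge> T" for t
  proof -
    have 1: "(Y has_vector_derivative Z u) (at u within {t..})" if "u \<ge> t" for u
      by (rule has_vector_derivative_at_within[OF Y]) (use T[of u] t that in auto)
    have 2: "(Z has_vector_derivative g u) (at u within {t..})" if "u \<ge> t" for u
      by (rule has_vector_derivative_at_within[OF Z]) (use T[of u] t that in auto)
    have 3: "norm (g u) \<le> L * M * u powr (-2 - p)" if "u \<ge> t" for u
    proof -
      have "norm (g u) \<le> L * u powr (-2 - p) * norm (Y u)" using g[of u] T[of u] t that by auto
      also have "\<dots> \<le> L * u powr (-2 - p) * M"
        using M[of u] t that L by (intro mult_left_mono) auto
      finally show ?thesis by (simp add: mult_ac)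
    qed
    have "t > 0" using T[OF t] by simp
    from double_tail_bound[OF p this 1 2 3 lim] show ?thesis by blast
  qed
  have "M \<le> M / 2"
  proof -
    have "norm (Y t) \<le> M / 2" if "t \<ge> T" for t
    proof -
      have "norm (Y t) \<le> M * (L / p * t powr (-p))" using b[OF that] by (simp add: mult_ac)
      also have "\<dots> \<le> M * (1 / 2)" using T[OF that] M0 by (intro mult_left_mono) auto
      finally show ?thesis by simp
    qed
    then show ?thesis unfolding M_def[symmetric] by (subst M_def, intro cSUP_least) auto
  qed
  then have "M = 0" using M0 by simp
  then have "Y t = 0 \<and> Z t = 0" if "t \<ge> T" for t using b[OF that] by simp
  then show thesis using that[of T] T[of T] by simp
qed

subsection \<open>Solutions close to an approximate solution\<close>

text \<open>Evaluation is 1-Lipschitz for the supremum distance. This makes pointwise norm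
  constraints closed conditions on bounded continuous functions.\<close>

lemma continuous_on_apply_bcontfun_at:
  "continuous_on S (\<lambda>r. apply_bcontfun r t)"
  unfolding continuous_on_iff
  using dist_bounded le_less_trans by blast

text \<open>Converts a general weight into a pure power of u with a constant anchored at t, the form
  in which the tail estimates accept it.\<close>

lemma weighted_power_bound:
  fixes h :: "real \<Rightarrow> real"
  assumes "0 < t" "t \<le> u" "h u \<le> h t * (t / u) powr \<eta>"
  shows "h u / u\<^sup>2 \<le> h t * t powr \<eta> * u powr (-2 - \<eta>)"
proof -
  have u: "u > 0" using assms by simp
  have "h u / u\<^sup>2 \<le> h t * (t / u) powr \<eta> / u\<^sup>2"
    using assms(3) u by (intro divide_right_mono) auto
  also have "\<dots> = h t * t powr \<eta> * u powr (-2 - \<eta>)"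
    using u assms(1) by (simp add: powr_divide powr_diff powr_minus field_simps power2_eq_square)
  finally show ?thesis .
qed

text \<open>Banach's fixed point theorem for the map sending r to the solution of Y'' = f(u, r) that
  vanishes at infinity. The factor \<eta> in \<open>bound\<close> cancels the 1 / \<eta> of the
  double integration, so the ball of weighted radius \<open>K\<close> is mapped to itself.\<close>

lemma second_order_tail_solution:
  fixes f :: "real \<Rightarrow> 'a::banach \<Rightarrow> 'a" and h :: "real \<Rightarrow> real"
  assumes pos: "\<eta> > 0" "p > 0" "T > 0" "K \<ge> 0" "C \<ge> 0"
    and h0: "\<And>t. T \<le> t \<Longrightarrow> h t \<ge> 0"
    and h: "\<And>t u. T \<le> t \<Longrightarrow> t \<le> u \<Longrightarrow> h u \<le> h t * (t / u) powr \<eta>"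
    and cont: "\<And>r. continuous_on {T..} r \<Longrightarrow> \<forall>t\<ge>T. norm (r t) \<le> K * h t \<Longrightarrow>
      continuous_on {T..} (\<lambda>u. f u (r u))"
    and bound: "\<And>u y. T \<le> u \<Longrightarrow> norm y \<le> K * h u \<Longrightarrow> norm (f u y) \<le> \<eta> * K * (h u / u\<^sup>2)"
    and lip: "\<And>u x y. T \<le> u \<Longrightarrow> norm x \<le> K * h u \<Longrightarrow> norm y \<le> K * h u \<Longrightarrow>
      norm (f u x - f u y) \<le> C * u powr (-2 - p) * norm (x - y)"
    and C: "C / p * T powr (-p) \<le> 1 / 2"
  shows "\<exists>Y Z. \<forall>u\<ge>T. (Y has_vector_derivative Z u) (at u within {T..}) \<and>
    (Z has_vector_derivative f u (Y u)) (at u within {T..}) \<and>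
    norm (Y u) \<le> K * h u \<and> norm (Z u) \<le> \<eta> * K * (h u / u)"
proof -
  \<comment> \<open>Bounded continuous functions live on the whole line; below \<open>T\<close> the
    weight is frozen at its value at \<open>T\<close>.\<close>
  define S where "S = {r :: real \<Rightarrow>\<^sub>C 'a. \<forall>t. norm (r t) \<le> K * h (max t T)}"
  define is_sol where "is_sol = (\<lambda>(r :: real \<Rightarrow> 'a) Y Z.
    (\<forall>u\<ge>T. (Y has_vector_derivative Z u) (at u within {T..}) \<and>
      (Z has_vector_derivative f u (r u)) (at u within {T..})) \<and>
    (Y \<longlongrightarrow> 0) at_top \<and> (Z \<longlongrightarrow> 0) at_top)"
  have SD: "norm (r t) \<le> K * h t" if "r \<in> S" "t \<ge> T" for r t
    using that unfolding S_def by (auto dest: spec[of _ t] simp: max_def)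
  have hT: "h t \<le> h T" if "t \<ge> T" for t
  proof -
    have "h t \<le> h T * (T / t) powr \<eta>" using h[of T t] that by simp
    also have "\<dots> \<le> h T * 1"
      using that pos h0[of T] by (intro mult_left_mono powr_le1) auto
    finally show ?thesis by simp
  qed
  \<comment> \<open>The constant is anchored at the variable time \<open>t\<close> instead of
    \<open>T\<close>; evaluating the tail bounds at \<open>t\<close> then cancels t^\<eta> and
    returns exactly \<open>h t\<close>.\<close>
  have g_bound: "norm (f u (r u)) \<le> \<eta> * K * h t * t powr \<eta> * u powr (-2 - \<eta>)"
    if "r \<in> S" "T \<le> t" "t \<le> u" for r t u
  proof -
    have "norm (f u (r u)) \<le> \<eta> * K * (h u / u\<^sup>2)"
      using bound SD that by simp
    also have "\<dots> \<le> \<eta> * K * (h t * t powr \<eta> * u powr (-2 - \<eta>))"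
      using that pos weighted_power_bound[of t u h \<eta>] h[of t u] by (intro mult_left_mono) auto
    finally show ?thesis by (simp add: mult_ac)
  qed
  have sol_bound: "norm (Z t) \<le> \<eta> * K * (h t / t) \<and> norm (Y t) \<le> K * h t"
    if "r \<in> S" "is_sol r Y Z" "T \<le> t" for r Y Z t
  proof -
    have "t > 0" using that(3) pos by simp
    have ode: "(Y has_vector_derivative Z u) (at u within {t..})"
      "(Z has_vector_derivative f u (r u)) (at u within {t..})" if "u \<ge> t" for u
      using \<open>is_sol r Y Z\<close> \<open>T \<le> t\<close> that unfolding is_sol_def
      by (auto intro: has_vector_derivative_within_subset[of _ _ u "{T..}" "{t..}"])
    have lim: "(Y \<longlongrightarrow> 0) at_top" "(Z \<longlongrightarrow> 0) at_top"
      using that(2) unfolding is_sol_def by simp_all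
    note b = double_tail_bound[OF pos(1) \<open>t > 0\<close> ode g_bound[OF that(1) that(3)] lim]
    have "t powr \<eta> * t powr (-1 - \<eta>) = 1 / t" "t powr \<eta> * t powr (-\<eta>) = 1"
      using \<open>t > 0\<close> by (simp_all add: powr_minus_divide flip: powr_add)
    then have "\<eta> * K * h t * t powr \<eta> * t powr (-1 - \<eta>) = \<eta> * K * (h t / t)"
      "\<eta> * K * h t * t powr \<eta> / \<eta> * t powr (-\<eta>) = K * h t"
      using pos(1) by (simp_all add: mult.assoc)
    with b show ?thesis by simp
  qed
  \<comment> \<open>The image is extended constantly to the left of \<open>T\<close>. The supremum
    distance also sees those times, and this reduces them to time \<open>T\<close>.\<close>
  have "\<exists>q Z. q \<in> S \<and> is_sol (apply_bcontfun r) (apply_bcontfun q) Z \<and> (\<forall>t. q t = q (max t T))" if r: "r \<in> S" for r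
  proof -
    have "continuous_on {T..} (\<lambda>u. f u (r u))"
      using SD[OF r] by (intro cont) auto
    then obtain Y Z where YZ: "\<And>u. u \<ge> T \<Longrightarrow> (Y has_vector_derivative Z u) (at u within {T..})"
      "\<And>u. u \<ge> T \<Longrightarrow> (Z has_vector_derivative f u (r u)) (at u within {T..})"
      "(Y \<longlongrightarrow> 0) at_top" "(Z \<longlongrightarrow> 0) at_top"
      by (rule double_tail_exists[OF pos(1,3) _ g_bound[OF r order.refl]]) (assumption, rule that)
    have sol: "is_sol r Y Z" unfolding is_sol_def using YZ by blast
    have Yb: "norm (Y t) \<le> K * h t" if "T \<le> t" for t
      using sol_bound[OF r sol that] by simp
    have cY: "continuous_on {T..} Y"
      unfolding continuous_on_eq_continuous_within
      using has_vector_derivative_continuous[OF YZ(1)] by simp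
    have "(\<lambda>t. Y (max t T)) \<in> bcontfun"
    proof -
      have "continuous_on UNIV (\<lambda>t. Y (max t T))"
        by (rule continuous_on_compose2[OF cY]) (auto intro!: continuous_intros)
      moreover have "norm (Y (max t T)) \<le> K * h T" for t
        using Yb[of "max t T"] mult_left_mono[OF hT[of "max t T"] pos(4)] by simp
      then have "bounded (range (\<lambda>t. Y (max t T)))"
        by (auto intro!: boundedI)
      ultimately show ?thesis by (simp add: bcontfun_def)
    qed
    then obtain q where q: "apply_bcontfun q = (\<lambda>t. Y (max t T))"
      by (metis bcontfunE)
    have qY: "q t = Y t" if "T \<le> t" for t using that by (simp add: q max_def)
    have "is_sol r q Z"
      unfolding is_sol_def
    proof (intro conjI allI impI YZ(2,4))
      fix u assume u: "T \<le> u"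
      show "(q has_vector_derivative Z u) (at u within {T..})"
        by (rule has_vector_derivative_transform[OF _ _ YZ(1)[OF u]]) (use u qY in auto)
    next
      show "(q \<longlongrightarrow> 0) at_top"
        using YZ(3) by (rule Lim_transform_eventually)
          (auto intro: eventually_mono[OF eventually_ge_at_top[of T]] simp: qY)
    qed
    moreover have "q \<in> S" using Yb unfolding S_def by (simp add: q)
    moreover have "\<forall>t. q t = q (max t T)" by (simp add: q)
    ultimately show ?thesis by blast
  qed
  then obtain \<Phi> \<Psi> where \<Phi>: "\<And>r. r \<in> S \<Longrightarrow> \<Phi> r \<in> S"
    "\<And>r. r \<in> S \<Longrightarrow> is_sol (apply_bcontfun r) (apply_bcontfun (\<Phi> r)) (\<Psi> r)"
    "\<And>r t. r \<in> S \<Longrightarrow> \<Phi> r t = \<Phi> r (max t T)"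
    by metis
  have contraction: "dist (\<Phi> r) (\<Phi> s) \<le> 1 / 2 * dist r s" if "r \<in> S" "s \<in> S" for r s
  proof (rule dist_bound)
    fix x
    define t where "t = max x T"
    have t: "T \<le> t" "0 < t" using pos by (auto simp: t_def)
    have ode: "((\<lambda>t. \<Phi> r t - \<Phi> s t) has_vector_derivative \<Psi> r u - \<Psi> s u) (at u within {t..})"
      "((\<lambda>t. \<Psi> r t - \<Psi> s t) has_vector_derivative f u (r u) - f u (s u)) (at u within {t..})"
      if "u \<ge> t" for u
      using \<Phi>(2)[OF \<open>r \<in> S\<close>] \<Phi>(2)[OF \<open>s \<in> S\<close>] t that unfolding is_sol_def
      by (auto intro!: has_vector_derivative_diff has_vector_derivative_within_subset[of _ _ u "{T..}" "{t..}"])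
    \<comment> \<open>Now the tail estimate is used with the exponent p and the constant C * dist r
      s; no weight enters, so the result is a contraction in the unweighted distance.\<close>
    have diff: "norm (f u (r u) - f u (s u)) \<le> C * dist r s * u powr (-2 - p)" if "u \<ge> t" for u
    proof -
      have "norm (f u (r u) - f u (s u)) \<le> C * u powr (-2 - p) * norm (r u - s u)"
        using \<open>r \<in> S\<close> \<open>s \<in> S\<close> SD t that by (intro lip) auto
      also have "\<dots> \<le> C * u powr (-2 - p) * dist r s"
        using pos dist_bounded[of r u s] by (intro mult_left_mono) (auto simp: dist_norm)
      finally show ?thesis by (simp add: mult_ac)
    qed
    have lim: "((\<lambda>t. \<Phi> r t - \<Phi> s t) \<longlongrightarrow> 0) at_top" "((\<lambda>t. \<Psi> r t - \<Psi> s t) \<longlongrightarrow> 0) at_top"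
      using \<Phi>(2)[OF \<open>r \<in> S\<close>] \<Phi>(2)[OF \<open>s \<in> S\<close>] unfolding is_sol_def
      using tendsto_diff[of _ 0 at_top _ 0] by force+
    have "dist (\<Phi> r x) (\<Phi> s x) = norm (\<Phi> r t - \<Phi> s t)"
      unfolding dist_norm t_def using \<Phi>(3) that by metis
    also have "\<dots> \<le> C * dist r s / p * t powr (-p)"
      by (rule double_tail_bound(2)[OF pos(2) t(2) ode diff lim])
    also have "\<dots> \<le> C * dist r s / p * T powr (-p)"
      using pos t by (intro mult_left_mono powr_mono2') auto
    also have "\<dots> = C / p * T powr (-p) * dist r s" by simp
    also have "\<dots> \<le> 1 / 2 * dist r s" using C by (intro mult_right_mono) auto
    finally show "dist (\<Phi> r x) (\<Phi> s x) \<le> 1 / 2 * dist r s" .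
  qed
  have "\<exists>!r\<in>S. \<Phi> r = r"
  proof (rule Banach_fix[where c = "1 / 2"])
    have "S = (\<Inter>t. {r. norm (apply_bcontfun r t) \<le> K * h (max t T)})"
      by (auto simp: S_def)
    moreover have "closed {r :: real \<Rightarrow>\<^sub>C 'a. norm (apply_bcontfun r t) \<le> K * h (max t T)}" for t
      by (intro closed_Collect_le continuous_intros continuous_on_apply_bcontfun_at)
    ultimately show "complete S" by (simp add: complete_eq_closed closed_INT)
    have "0 \<le> K * h (max t T)" for t using pos h0 by simp
    then have "const_bcontfun 0 \<in> S" by (simp add: S_def const_bcontfun.rep_eq)
    then show "S \<noteq> {}" by blast
    show "\<Phi> ` S \<subseteq> S" using \<Phi>(1) by blast
  qed (use contraction in auto)
  then obtain r where r: "r \<in> S" "\<Phi> r = r" by blast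
  then have "is_sol r r (\<Psi> r)" using \<Phi>(2)[OF r(1)] by simp
  then show ?thesis
    using sol_bound[OF r(1)] unfolding is_sol_def by blast
qed

lemma bigo_tendsto_0:
  fixes f g :: "'a \<Rightarrow> real"
  assumes "f \<in> O[F](g)" "(g \<longlongrightarrow> 0) F"
  shows "(f \<longlongrightarrow> 0) F"
proof -
  obtain c where "\<forall>\<^sub>F x in F. norm (f x) \<le> c * norm (g x)"
    using landau_o.bigE[OF assms(1)] by blast
  moreover have "((\<lambda>x. c * norm (g x)) \<longlongrightarrow> 0) F"
    by (intro tendsto_mult_right_zero tendsto_norm_zero assms(2))
  ultimately show ?thesis by (rule Lim_null_comparison)
qed

text \<open>Existence and uniqueness once an approximate solution \<open>A\<close> with A'' =
  \<open>G\<close> is known. A defect of size h / t^2 becomes, after two integrations, an error of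
  size h in position and h / t in velocity.\<close>

lemma nbody_solution_near_approximation:
  fixes m :: "'N::finite \<Rightarrow> real" and v :: "real^'d^'N"
  assumes m: "\<And>i. m i > 0" and p: "p > 0" and v: "v \<in> collision_free"
    and \<eta>: "\<eta> > 0" and T1: "T1 > 0"
    and A: "\<And>t. t \<ge> T1 \<Longrightarrow> (A has_vector_derivative B t) (at t)"
    and B: "\<And>t. t \<ge> T1 \<Longrightarrow> (B has_vector_derivative G t) (at t)"
    and G: "continuous_on {T1..} G"
    and A_lim: "((\<lambda>t. norm (A t - t *\<^sub>R v) / t) \<longlongrightarrow> 0) at_top"
    and h0: "\<And>t. T1 \<le> t \<Longrightarrow> h t \<ge> 0"
    and h: "\<And>t u. T1 \<le> t \<Longrightarrow> t \<le> u \<Longrightarrow> h u \<le> h t * (t / u) powr \<eta>"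
    and defect: "(\<lambda>t. norm (force m p (A t) - G t)) \<in> O[at_top](\<lambda>t. h t / t\<^sup>2)"
  shows "\<exists>T0>0. has_unique_nbody_solution m p T0 (\<lambda>\<alpha> \<beta>.
    (\<lambda>t. norm (\<alpha> t - A t)) \<in> O[at_top](h) \<and> (\<lambda>t. norm (\<beta> t - B t)) \<in> O[at_top](\<lambda>t. h t / t))"
proof -
  obtain \<delta> L where \<delta>: "\<delta> > 0" and L: "L > 0"
    and cf: "\<And>t a. t > 0 \<Longrightarrow> norm (a - t *\<^sub>R v) \<le> \<delta> * t \<Longrightarrow> a \<in> collision_free"
    and lip: "\<And>t a b. t > 0 \<Longrightarrow> norm (a - t *\<^sub>R v) \<le> \<delta> * t \<Longrightarrow> norm (b - t *\<^sub>R v) \<le> \<delta> * t \<Longrightarrow>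
      norm (force m p a - force m p b) \<le> L * t powr (-2 - p) * norm (a - b)"
    by (rule force_lipschitz_on_cone[of m p v, OF m p v]) (rule that)
  obtain D where D: "D > 0" and
    defect': "\<forall>\<^sub>F t in at_top. norm (norm (force m p (A t) - G t)) \<le> D * norm (h t / t\<^sup>2)"
    using landau_o.bigE[OF defect] by blast
  \<comment> \<open>Invariance allows a right-hand side of size \<eta> K h / u^2 = 2 D h / u^2. One
    D pays for the defect, the other for the Lipschitz term, which is at most L K u^(-p) h /
    u^2.\<close>
  define K where "K = 2 * D / \<eta>"
  have K: "K > 0" "\<eta> * K = 2 * D" using D \<eta> by (simp_all add: K_def)
  have powr_lim: "((\<lambda>t. c * t powr (-s)) \<longlongrightarrow> 0) at_top" if "s > 0" for c s :: real
    using that by (intro tendsto_mult_right_zero tendsto_neg_powr filterlim_ident) auto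
  have A_half: "\<forall>\<^sub>F t in at_top. norm (A t - t *\<^sub>R v) / t < \<delta> / 2"
    by (rule order_tendstoD(2)[OF A_lim]) (use \<delta> in simp)
  \<comment> \<open>Thresholds for \<open>T\<close>: \<open>A\<close> and the remainder each use up
    half of the cone opening (the bound by \<open>h T1\<close> relies on \<open>h\<close> not
    growing), the Lipschitz term stays below D, and the map contracts by 1/2.\<close>
  have "\<forall>\<^sub>F t in at_top. t \<ge> T1 \<and> t \<ge> 2 * K * h T1 / \<delta> \<and> norm (A t - t *\<^sub>R v) / t < \<delta> / 2 \<and>
      norm (norm (force m p (A t) - G t)) \<le> D * norm (h t / t\<^sup>2) \<and>
      L * K * t powr (-p) < D \<and> L / p * t powr (-p) < 1 / 2"
    by (intro eventually_conj eventually_ge_at_top A_half defect' order_tendstoD(2)[OF powr_lim] p D)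
      auto
  then obtain T where T: "\<And>t. t \<ge> T \<Longrightarrow> t \<ge> T1 \<and> t \<ge> 2 * K * h T1 / \<delta> \<and>
      norm (A t - t *\<^sub>R v) / t < \<delta> / 2 \<and>
      norm (norm (force m p (A t) - G t)) \<le> D * norm (h t / t\<^sup>2) \<and>
      L * K * t powr (-p) < D \<and> L / p * t powr (-p) < 1 / 2"
    unfolding eventually_at_top_linorder by blast
  have T0: "T > 0" using T[of T] T1 by simp
  have h_le: "h t \<le> h T1 * T1 powr \<eta> * t powr (-\<eta>)" if "t \<ge> T1" for t
    using h[of T1 t] that T1 by (simp add: powr_divide powr_minus_divide)
  have hT1: "h t \<le> h T1" if "t \<ge> T1" for t
  proof -
    have "h t \<le> h T1 * (T1 / t) powr \<eta>" using h[of T1 t] that by simp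
    also have "\<dots> \<le> h T1 * 1"
      using that T1 \<eta> h0[of T1] by (intro mult_left_mono powr_le1) auto
    finally show ?thesis by simp
  qed
  have h_lim: "(h \<longlongrightarrow> 0) at_top"
  proof (rule Lim_null_comparison[OF _ powr_lim[OF \<eta>]])
    show "\<forall>\<^sub>F t in at_top. norm (h t) \<le> h T1 * T1 powr \<eta> * t powr (-\<eta>)"
      using eventually_ge_at_top[of T1] by eventually_elim (use h0 h_le in simp)
  qed
  have A_cone: "norm (A t - t *\<^sub>R v) \<le> \<delta> / 2 * t" if "t \<ge> T" for t
    using T[OF that] that T0 by (simp add: field_simps)
  have cone: "norm ((A t + y) - t *\<^sub>R v) \<le> \<delta> * t" if t: "t \<ge> T" and y: "norm y \<le> K * h t" for t y
  proof -
    have "norm ((A t + y) - t *\<^sub>R v) \<le> norm (A t - t *\<^sub>R v) + norm y"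
      using norm_triangle_ineq[of "A t - t *\<^sub>R v" y] by (simp add: algebra_simps)
    moreover have "K * h t \<le> K * h T1" using K hT1[of t] T[OF t] by simp
    moreover have "K * h T1 \<le> \<delta> / 2 * t" using T[OF t] \<delta> by (simp add: field_simps)
    ultimately show ?thesis using A_cone[OF t] y by simp
  qed
  have cont_A: "continuous_on {T..} A"
    using T[of T] by (intro continuous_at_imp_continuous_on ballI has_vector_derivative_continuous[OF A]) auto
  define f where "f = (\<lambda>u y. force m p (A u + y) - G u)"
  have "\<exists>Y Z. \<forall>u\<ge>T. (Y has_vector_derivative Z u) (at u within {T..}) \<and>
    (Z has_vector_derivative f u (Y u)) (at u within {T..}) \<and>
    norm (Y u) \<le> K * h u \<and> norm (Z u) \<le> \<eta> * K * (h u / u)"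
  proof (rule second_order_tail_solution[OF \<eta> p T0])
    show "0 \<le> K" "0 \<le> L" using K L by auto
    show "0 \<le> h t" if "T \<le> t" for t using h0 T[OF that] by simp
    show "h u \<le> h t * (t / u) powr \<eta>" if "T \<le> t" "t \<le> u" for t u
      using h that T[of t] by simp
    show "L / p * T powr (-p) \<le> 1 / 2" using T[of T] by simp
    show "continuous_on {T..} (\<lambda>u. f u (r u))"
      if "continuous_on {T..} r" "\<forall>t\<ge>T. norm (r t) \<le> K * h t" for r
    proof -
      have "A u + r u \<in> collision_free" if "u \<ge> T" for u
        using cf[of u] cone[OF that] \<open>\<forall>t\<ge>T. norm (r t) \<le> K * h t\<close> that T0 by simp
      then have "continuous_on {T..} (\<lambda>u. force m p (A u + r u))"
        by (intro continuous_on_compose2[OF continuous_on_force[OF p, of m]] continuous_on_add cont_A that)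
          auto
      moreover have "continuous_on {T..} G"
        using T[of T] by (intro continuous_on_subset[OF G]) auto
      ultimately show ?thesis unfolding f_def by (intro continuous_on_diff)
    qed
    have lip': "norm (f u x - f u y) \<le> L * u powr (-2 - p) * norm (x - y)"
      if "T \<le> u" "norm x \<le> K * h u" "norm y \<le> K * h u" for u x y
      using lip[of u "A u + x" "A u + y"] cone that T0 by (simp add: f_def)
    then show "norm (f u x - f u y) \<le> L * u powr (-2 - p) * norm (x - y)"
      if "T \<le> u" "norm x \<le> K * h u" "norm y \<le> K * h u" for u x y
      using that .
    show "norm (f u y) \<le> \<eta> * K * (h u / u\<^sup>2)" if u: "T \<le> u" and y: "norm y \<le> K * h u" for u y
    proof -
      have pos: "u > 0" "h u \<ge> 0" using u T0 T[OF u] h0 by auto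
      have "norm (f u y) \<le> norm (f u 0) + norm (f u y - f u 0)"
        by (metis norm_triangle_sub)
      also have "norm (f u 0) \<le> D * (h u / u\<^sup>2)"
        using T[OF u] pos by (simp add: f_def)
      also have "norm (f u y - f u 0) \<le> L * u powr (-2 - p) * norm (y - 0)"
        using K pos by (intro lip' u y) auto
      also have "\<dots> \<le> L * u powr (-2 - p) * (K * h u)"
        using y L by (intro mult_left_mono) auto
      also have "\<dots> = L * K * u powr (-p) * (h u / u\<^sup>2)"
        using pos by (simp add: powr_diff powr_minus field_simps)
      also have "\<dots> \<le> D * (h u / u\<^sup>2)"
        using T[OF u] pos by (intro mult_right_mono) auto
      finally show ?thesis using K by simp
    qed
  qed
  then obtain Y Z where Y: "\<And>u. u \<ge> T \<Longrightarrow> (Y has_vector_derivative Z u) (at u within {T..})"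
    and Z: "\<And>u. u \<ge> T \<Longrightarrow> (Z has_vector_derivative f u (Y u)) (at u within {T..})"
    and Yb: "\<And>u. u \<ge> T \<Longrightarrow> norm (Y u) \<le> K * h u"
    and Zb: "\<And>u. u \<ge> T \<Longrightarrow> norm (Z u) \<le> \<eta> * K * (h u / u)"
    by metis
  define \<alpha> where "\<alpha> = (\<lambda>t. A t + Y t)"
  define \<beta> where "\<beta> = (\<lambda>t. B t + Z t)"
  have sol: "nbody_solution m p T \<alpha> \<beta>"
    unfolding nbody_solution_iff_force[of m, OF m]
  proof (intro allI impI conjI)
    fix t assume t: "T < t"
    have at: "at t within {T..} = at t"
      using t at_within_interior[of t "{T..}"] by simp
    show "\<alpha> t \<in> collision_free"
      unfolding \<alpha>_def using t T0 by (intro cf[of t] cone Yb) auto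
    show "(\<alpha> has_vector_derivative \<beta> t) (at t)"
      unfolding \<alpha>_def \<beta>_def
      using t T[of t] Y[of t] at by (intro has_vector_derivative_add A) auto
    have "(\<beta> has_vector_derivative G t + f t (Y t)) (at t)"
      unfolding \<beta>_def
      using t T[of t] Z[of t] at by (intro has_vector_derivative_add B) auto
    then show "(\<beta> has_vector_derivative force m p (\<alpha> t)) (at t)"
      by (simp add: f_def \<alpha>_def)
  qed
  have asym: "(\<lambda>t. norm (\<alpha> t - A t)) \<in> O[at_top](h)" "(\<lambda>t. norm (\<beta> t - B t)) \<in> O[at_top](\<lambda>t. h t / t)"
  proof -
    show "(\<lambda>t. norm (\<alpha> t - A t)) \<in> O[at_top](h)"
    proof (rule bigoI[of _ K])
      show "\<forall>\<^sub>F t in at_top. norm (norm (\<alpha> t - A t)) \<le> K * norm (h t)"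
        using eventually_ge_at_top[of T]
      proof eventually_elim
        case (elim t)
        then show ?case using Yb[of t] h0[of t] T[of t] by (simp add: \<alpha>_def)
      qed
    qed
    show "(\<lambda>t. norm (\<beta> t - B t)) \<in> O[at_top](\<lambda>t. h t / t)"
    proof (rule bigoI[of _ "\<eta> * K"])
      show "\<forall>\<^sub>F t in at_top. norm (norm (\<beta> t - B t)) \<le> \<eta> * K * norm (h t / t)"
        using eventually_ge_at_top[of T]
      proof eventually_elim
        case (elim t)
        then show ?case using Zb[of t] h0[of t] T[of t] T0 by (simp add: \<beta>_def)
      qed
    qed
  qed
  have lim0: "((\<lambda>t. a t - A t) \<longlongrightarrow> 0) at_top"
    if "(\<lambda>t. norm (a t - A t)) \<in> O[at_top](h)" for a :: "real \<Rightarrow> real^'d^'N"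
    by (rule tendsto_norm_zero_cancel[OF bigo_tendsto_0[OF that h_lim]])
  have h1_lim: "((\<lambda>t. h t / t) \<longlongrightarrow> 0) at_top"
    by (rule real_tendsto_divide_at_top[OF h_lim filterlim_ident])
  have lim1: "((\<lambda>t. b t - B t) \<longlongrightarrow> 0) at_top"
    if "(\<lambda>t. norm (b t - B t)) \<in> O[at_top](\<lambda>t. h t / t)" for b :: "real \<Rightarrow> real^'d^'N"
    by (rule tendsto_norm_zero_cancel[OF bigo_tendsto_0[OF that h1_lim]])
  \<comment> \<open>A competing solution is known to be within o(1) of \<open>A\<close>, while the
    cone widens linearly; from t >= 1 on its free half \<delta> t / 2 exceeds \<delta> / 2.\<close>
  have eventually_cone: "\<forall>\<^sub>F t in at_top. norm (a t - t *\<^sub>R v) \<le> \<delta> * t"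
    if "((\<lambda>t. a t - A t) \<longlongrightarrow> 0) at_top" for a :: "real \<Rightarrow> real^'d^'N"
  proof -
    have "\<forall>\<^sub>F t in at_top. norm (a t - A t) < \<delta> / 2"
      by (rule order_tendstoD(2)[OF tendsto_norm_zero[OF that]]) (use \<delta> in simp)
    moreover have "\<forall>\<^sub>F t::real in at_top. t \<ge> max T 1" by (rule eventually_ge_at_top)
    ultimately show ?thesis
    proof eventually_elim
      case (elim t)
      have "norm (a t - t *\<^sub>R v) \<le> norm (a t - A t) + norm (A t - t *\<^sub>R v)"
        using norm_triangle_ineq[of "a t - A t" "A t - t *\<^sub>R v"] by simp
      moreover have "\<delta> / 2 \<le> \<delta> / 2 * t" using elim \<delta> by simp
      ultimately show ?case using elim A_cone[of t] by simp
    qed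
  qed
  have unique: "\<alpha>' t = \<alpha> t \<and> \<beta>' t = \<beta> t"
    if sol': "nbody_solution m p T \<alpha>' \<beta>'"
      and asym': "(\<lambda>t. norm (\<alpha>' t - A t)) \<in> O[at_top](h)" "(\<lambda>t. norm (\<beta>' t - B t)) \<in> O[at_top](\<lambda>t. h t / t)"
      and t: "t > T" for \<alpha>' \<beta>' t
  proof -
    note ode = sol[unfolded nbody_solution_iff_force[of m, OF m], rule_format]
    note ode' = sol'[unfolded nbody_solution_iff_force[of m, OF m], rule_format]
    have "\<forall>\<^sub>F t in at_top. norm (\<alpha>' t - t *\<^sub>R v) \<le> \<delta> * t \<and> norm (\<alpha> t - t *\<^sub>R v) \<le> \<delta> * t \<and> t > T"
      by (intro eventually_conj eventually_cone lim0 asym asym' eventually_gt_at_top)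
    then obtain T2 where T2: "\<And>t. t \<ge> T2 \<Longrightarrow>
        norm (\<alpha>' t - t *\<^sub>R v) \<le> \<delta> * t \<and> norm (\<alpha> t - t *\<^sub>R v) \<le> \<delta> * t \<and> t > T"
      unfolding eventually_at_top_linorder by blast
    have d1: "((\<lambda>t. \<alpha>' t - \<alpha> t) has_vector_derivative \<beta>' u - \<beta> u) (at u)"
      and d2: "((\<lambda>t. \<beta>' t - \<beta> t) has_vector_derivative force m p (\<alpha>' u) - force m p (\<alpha> u)) (at u)"
      and d3: "norm (force m p (\<alpha>' u) - force m p (\<alpha> u)) \<le> L * u powr (-2 - p) * norm (\<alpha>' u - \<alpha> u)"
      if "u \<ge> T2" for u
      using ode[of u] ode'[of u] T2[OF that] T0 lip[of u "\<alpha>' u" "\<alpha> u"]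
      by (auto intro!: has_vector_derivative_diff)
    have l1: "((\<lambda>t. \<alpha>' t - \<alpha> t) \<longlongrightarrow> 0) at_top"
      using tendsto_diff[OF lim0[OF asym'(1)] lim0[OF asym(1)]] by simp
    have l2: "((\<lambda>t. \<beta>' t - \<beta> t) \<longlongrightarrow> 0) at_top"
      using tendsto_diff[OF lim1[OF asym'(2)] lim1[OF asym(2)]] by simp
    obtain T3 where T3: "T3 \<ge> T2" "\<And>t. t \<ge> T3 \<Longrightarrow> \<alpha>' t - \<alpha> t = 0 \<and> \<beta>' t - \<beta> t = 0"
      by (rule tail_linear_uniqueness[OF p L d1 d2 d3 l1 l2]) (assumption, assumption, assumption, rule that)
    show ?thesis
    proof (cases "t \<ge> T3")
      case False
      then show ?thesis
        using nbody_backward_uniqueness[of m, OF m p sol sol', of T3 t] T3(2)[of T3] t by simp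
    qed (use T3(2) in simp)
  qed
  show ?thesis
    unfolding has_unique_nbody_solution_def
    using T0 sol asym unique by blast
qed

subsection \<open>Expansion of the force along polynomial paths\<close>

text \<open>An asymptotic expansion of every order, in place of smoothness: closure under sums and
  products is then algebra with remainders. One side of 0 suffices since s = t^(-p) is positive. The
  polynomial may depend on the order.\<close>

definition taylor_expandable :: "(real \<Rightarrow> real) \<Rightarrow> bool" where
  "taylor_expandable f \<longleftrightarrow> (\<forall>N. \<exists>q. (\<lambda>s. f s - poly q s) \<in> O[at_right 0](\<lambda>s. s ^ N))"

lemma poly_tendsto_at_right_0: "(poly q \<longlongrightarrow> poly q 0) (at_right (0 :: real))"
proof -
  have "isCont (poly q) 0" by simp
  then show ?thesis by (simp add: isCont_def filterlim_at_split)
qed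

lemma poly_bigo_1: "(\<lambda>s. poly q s) \<in> O[at_right 0](\<lambda>s. 1 :: real)"
  by (rule bigoI_tendsto[of _ _ "poly q 0"]) (simp_all add: poly_tendsto_at_right_0)

lemma power_bigo_power: "n \<le> k \<Longrightarrow> (\<lambda>s. s ^ k) \<in> O[at_right 0](\<lambda>s. s ^ n :: real)"
  using poly_bigo_1[of "monom 1 (k - n)"] landau_o.big.mult_left[of _ _ _ "\<lambda>s. s ^ n"]
  by (fastforce simp: poly_monom simp flip: power_add)

lemma taylor_expandable_poly: "taylor_expandable (poly q)"
  unfolding taylor_expandable_def by (auto intro: exI[of _ q])

lemma taylor_expandable_add:
  assumes "taylor_expandable f" "taylor_expandable g"
  shows "taylor_expandable (\<lambda>s. f s + g s)"
  unfolding taylor_expandable_def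
proof
  fix N
  obtain q r where "(\<lambda>s. f s - poly q s) \<in> O[at_right 0](\<lambda>s. s ^ N)"
    "(\<lambda>s. g s - poly r s) \<in> O[at_right 0](\<lambda>s. s ^ N)"
    using assms unfolding taylor_expandable_def by blast
  then have "(\<lambda>s. (f s - poly q s) + (g s - poly r s)) \<in> O[at_right 0](\<lambda>s. s ^ N)"
    by (rule sum_in_bigo)
  then show "\<exists>q. (\<lambda>s. f s + g s - poly q s) \<in> O[at_right 0](\<lambda>s. s ^ N)"
    by (intro exI[of _ "q + r"]) (simp add: algebra_simps)
qed

lemma taylor_expandable_mult:
  assumes "taylor_expandable f" "taylor_expandable g"
  shows "taylor_expandable (\<lambda>s. f s * g s)"
  unfolding taylor_expandable_def
proof
  fix N
  obtain q r where f: "(\<lambda>s. f s - poly q s) \<in> O[at_right 0](\<lambda>s. s ^ N)"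
    and g: "(\<lambda>s. g s - poly r s) \<in> O[at_right 0](\<lambda>s. s ^ N)"
    using assms unfolding taylor_expandable_def by blast
  have "(\<lambda>s. f s - poly q s) \<in> O[at_right 0](\<lambda>s. 1)"
    using landau_o.big_trans[OF f power_bigo_power[of 0 N]] by simp
  \<comment> \<open>Uses f g - q r = (f - q)(g - r) + q (g - r) + r (f - q): in each product one
    factor is O(s^N) and the other bounded.\<close>
  then have "(\<lambda>s. (f s - poly q s) * (g s - poly r s)) \<in> O[at_right 0](\<lambda>s. 1 * s ^ N)"
    using g by (rule landau_o.big.mult)
  moreover have "(\<lambda>s. poly q s * (g s - poly r s)) \<in> O[at_right 0](\<lambda>s. 1 * s ^ N)"
    using poly_bigo_1 g by (rule landau_o.big.mult)
  moreover have "(\<lambda>s. poly r s * (f s - poly q s)) \<in> O[at_right 0](\<lambda>s. 1 * s ^ N)"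
    using poly_bigo_1 f by (rule landau_o.big.mult)
  ultimately have "(\<lambda>s. (f s - poly q s) * (g s - poly r s) + poly q s * (g s - poly r s)
      + poly r s * (f s - poly q s)) \<in> O[at_right 0](\<lambda>s. 1 * s ^ N)"
    by (intro sum_in_bigo)
  then show "\<exists>q. (\<lambda>s. f s * g s - poly q s) \<in> O[at_right 0](\<lambda>s. s ^ N)"
    by (intro exI[of _ "q * r"]) (simp add: algebra_simps)
qed

lemma taylor_expandable_const: "taylor_expandable (\<lambda>s. c)"
  using taylor_expandable_poly[of "[:c:]"] by (simp add: taylor_expandable_def)

lemma taylor_expandable_cmult: "taylor_expandable f \<Longrightarrow> taylor_expandable (\<lambda>s. c * f s)"
  by (intro taylor_expandable_mult taylor_expandable_const)

lemma taylor_expandable_minus: "taylor_expandable f \<Longrightarrow> taylor_expandable (\<lambda>s. - f s)"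
  using taylor_expandable_cmult[of f "-1"] by simp

lemma taylor_expandable_sum:
  "(\<And>i. i \<in> I \<Longrightarrow> taylor_expandable (f i)) \<Longrightarrow> taylor_expandable (\<lambda>s. \<Sum>i\<in>I. f i s)"
  by (induction I rule: infinite_finite_induct)
    (auto intro: taylor_expandable_const taylor_expandable_add)

text \<open>For |x| <= 1/2 the tail of the generalized binomial series is |x|^N times a series
  dominated by \<open>c\<close>, which is independent of x.\<close>

lemma binomial_series_remainder:
  fixes a :: real
  shows "(\<lambda>x. (1 + x) powr a - (\<Sum>k<N. (a gchoose k) * x ^ k)) \<in> O[nhds 0](\<lambda>x. x ^ N)"
proof -
  define c where "c = (\<lambda>k. \<bar>a gchoose (k + N)\<bar> * (1 / 2) ^ k)"
  \<comment> \<open>Convergence at 3/4 implies absolute convergence at the smaller radius 1/2. The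
    factor 2^N below undoes the (1/2)^N picked up by the index shift.\<close>
  have "summable (\<lambda>k. (a gchoose k) * (3 / 4) ^ k)"
    using gen_binomial_real[of "3 / 4" a] by (auto simp: sums_iff)
  then have "summable (\<lambda>k. norm ((a gchoose k) * (1 / 2) ^ k))"
    by (rule powser_insidea) simp
  then have "summable (\<lambda>k. norm ((a gchoose (k + N)) * (1 / 2) ^ (k + N)))"
    by (rule summable_ignore_initial_segment)
  then have "summable (\<lambda>k. 2 ^ N * norm ((a gchoose (k + N)) * (1 / 2) ^ (k + N)))"
    by (rule summable_mult)
  then have c: "summable c"
    by (simp add: c_def abs_mult power_add field_simps)
  show ?thesis
  proof (rule bigoI[of _ "suminf c"])
    have "\<forall>\<^sub>F x :: real in nhds 0. x \<in> {-1/2<..<1/2}"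
      by (rule eventually_nhds_in_open) auto
    then show "\<forall>\<^sub>F x in nhds 0. norm ((1 + x) powr a - (\<Sum>k<N. (a gchoose k) * x ^ k)) \<le> suminf c * norm (x ^ N)"
    proof eventually_elim
      case (elim x)
      then have x: "\<bar>x\<bar> \<le> 1 / 2" by auto
      have s: "(\<lambda>k. (a gchoose k) * x ^ k) sums (1 + x) powr a"
        using gen_binomial_real[of x a] x by simp
      have t: "(\<lambda>k. (a gchoose (k + N)) * x ^ (k + N)) sums
          ((1 + x) powr a - (\<Sum>k<N. (a gchoose k) * x ^ k))"
        by (rule sums_split_initial_segment[OF s])
      have le: "norm ((a gchoose (k + N)) * x ^ (k + N)) \<le> c k * \<bar>x\<bar> ^ N" for k
      proof -
        have "\<bar>x\<bar> ^ k \<le> (1 / 2) ^ k" using x by (intro power_mono) auto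
        then have "\<bar>a gchoose (k + N)\<bar> * \<bar>x\<bar> ^ N * \<bar>x\<bar> ^ k \<le> \<bar>a gchoose (k + N)\<bar> * \<bar>x\<bar> ^ N * (1 / 2) ^ k"
          by (intro mult_left_mono) auto
        then show ?thesis by (simp add: c_def abs_mult power_abs power_add mult_ac)
      qed
      have "norm (\<Sum>k. (a gchoose (k + N)) * x ^ (k + N)) \<le> (\<Sum>k. c k * \<bar>x\<bar> ^ N)"
        by (rule norm_suminf_le[OF le summable_mult2[OF c]])
      then show ?case
        using t c by (simp add: sums_iff suminf_mult2 power_abs)
    qed
  qed
qed

text \<open>Write q = q(0) (1 + u) with u(0) = 0. Then u = O(s), and substituting u into the
  truncated binomial series gives a polynomial with remainder O(u^N) = O(s^N).\<close>

lemma taylor_expandable_poly_powr: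
  fixes q :: "real poly"
  assumes q0: "poly q 0 > 0"
  shows "taylor_expandable (\<lambda>s. poly q s powr a)"
  unfolding taylor_expandable_def
proof
  fix N
  define u where "u = smult (1 / poly q 0) q - 1"
  have u0: "poly u 0 = 0" using q0 by (simp add: u_def)
  then obtain w where w: "u = pCons 0 w" by (metis poly_0_coeff_0 coeff_pCons_0 pCons_cases)
  have lim: "filterlim (poly u) (nhds 0) (at_right 0)"
    using poly_tendsto_at_right_0[of u] by (simp add: u0)
  have "poly u \<in> O[at_right 0](\<lambda>s. s)"
    using landau_o.big.mult_left[OF poly_bigo_1[of w], of "\<lambda>s. s"]
    by (simp add: w poly_pCons[abs_def])
  then have uN: "(\<lambda>s. poly u s ^ N) \<in> O[at_right 0](\<lambda>s. s ^ N)"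
    by (rule landau_o.big_power)
  have "(\<lambda>s. (1 + poly u s) powr a - (\<Sum>k<N. (a gchoose k) * poly u s ^ k)) \<in> O[at_right 0](\<lambda>s. poly u s ^ N)"
    by (rule landau_o.big.compose[OF binomial_series_remainder lim])
  from landau_o.big.mult_left[OF landau_o.big_trans[OF this uN], of "\<lambda>s. poly q 0 powr a"]
  have "(\<lambda>s. poly q 0 powr a * ((1 + poly u s) powr a - (\<Sum>k<N. (a gchoose k) * poly u s ^ k)))
      \<in> O[at_right 0](\<lambda>s. s ^ N)"
    using q0 by simp
  moreover have "\<forall>\<^sub>F s in at_right 0. poly q 0 powr a * ((1 + poly u s) powr a - (\<Sum>k<N. (a gchoose k) * poly u s ^ k))
      = poly q s powr a - poly (smult (poly q 0 powr a) (\<Sum>k<N. smult (a gchoose k) (u ^ k))) s"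
  proof -
    have "\<forall>\<^sub>F s in at_right 0. poly u s > -1"
      by (rule order_tendstoD(1)[OF lim]) simp
    then show ?thesis
    proof eventually_elim
      case (elim s)
      have "poly q s = poly q 0 * (1 + poly u s)" using q0 by (simp add: u_def field_simps)
      then have "poly q s powr a = poly q 0 powr a * (1 + poly u s) powr a"
        using elim q0 by (simp add: powr_mult)
      then show ?case by (simp add: poly_sum right_diff_distrib)
    qed
  qed
  ultimately show "\<exists>r. (\<lambda>s. poly q s powr a - poly r s) \<in> O[at_right 0](\<lambda>s. s ^ N)"
    using landau_o.big.in_cong by fast
qed

text \<open>The number \<open>g\<close> is the coefficient of s^m. A polynomial of size O(s^(m+1))
  tends to 0, so its constant coefficient vanishes and one factor s can be cancelled; this drives
  the induction.\<close>

lemma poly_leading_coefficient_at_0: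
  fixes q :: "real poly"
  assumes "poly q \<in> O[at_right 0](\<lambda>s. s ^ m)"
  shows "\<exists>g. (\<lambda>s. poly q s - g * s ^ m) \<in> O[at_right 0](\<lambda>s. s ^ Suc m)"
  using assms
proof (induction m arbitrary: q)
  case 0
  obtain a r where q: "q = pCons a r" by (cases q)
  have "(\<lambda>s. s * poly r s) \<in> O[at_right 0](\<lambda>s. s * 1)"
    by (rule landau_o.big.mult_left[OF poly_bigo_1])
  then show ?case by (intro exI[of _ a]) (simp add: q)
next
  case (Suc m)
  obtain a r where q: "q = pCons a r" by (cases q)
  have id_lim: "((\<lambda>s::real. s) \<longlongrightarrow> 0) (at_right 0)" by (rule tendsto_ident_at)
  have "((\<lambda>s::real. s ^ Suc m) \<longlongrightarrow> 0) (at_right 0)"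
    using tendsto_power[OF id_lim, of "Suc m"] by simp
  then have "(poly q \<longlongrightarrow> 0) (at_right 0)"
    by (rule bigo_tendsto_0[OF Suc.prems])
  moreover have "(poly q \<longlongrightarrow> poly q 0) (at_right 0)"
    by (rule poly_tendsto_at_right_0)
  ultimately have "poly q 0 = 0" by (rule tendsto_unique[OF trivial_limit_at_right_real, rotated])
  then have a: "a = 0" by (simp add: q)
  have "(\<lambda>s. s * poly r s) \<in> O[at_right 0](\<lambda>s. s * s ^ m)" using Suc.prems by (simp add: q a)
  moreover have "\<forall>\<^sub>F s::real in at_right 0. s \<noteq> 0"
    using eventually_at_right_less[of "0::real"] by eventually_elim simp
  ultimately have "poly r \<in> O[at_right 0](\<lambda>s. s ^ m)"
    using landau_o.big.mult_cancel_left[OF bigtheta_refl, of "\<lambda>s. s" "at_right 0" "poly r" "\<lambda>s. s ^ m"] by blast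
  from Suc.IH[OF this] obtain g where "(\<lambda>s. poly r s - g * s ^ m) \<in> O[at_right 0](\<lambda>s. s ^ Suc m)" ..
  from landau_o.big.mult_left[OF this, of "\<lambda>s. s"]
  show ?case by (intro exI[of _ g]) (simp add: q a algebra_simps)
qed

text \<open>An approximating polynomial of order m + 1 differs from \<open>f\<close> by less than
  s^m in order, so it inherits the size O(s^m) and its coefficient of s^m serves for
  \<open>f\<close>.\<close>

lemma taylor_expandable_leading_coefficient:
  assumes "taylor_expandable f" "f \<in> O[at_right 0](\<lambda>s. s ^ m)"
  shows "\<exists>g. (\<lambda>s. f s - g * s ^ m) \<in> O[at_right 0](\<lambda>s. s ^ Suc m)"
proof -
  obtain q where q: "(\<lambda>s. f s - poly q s) \<in> O[at_right 0](\<lambda>s. s ^ Suc m)"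
    using assms(1) unfolding taylor_expandable_def by blast
  have "(\<lambda>s. f s - (f s - poly q s)) \<in> O[at_right 0](\<lambda>s. s ^ m)"
    by (rule sum_in_bigo(2)[OF assms(2) landau_o.big_trans[OF q power_bigo_power]]) simp
  then have "poly q \<in> O[at_right 0](\<lambda>s. s ^ m)" by (simp add: algebra_simps)
  from poly_leading_coefficient_at_0[OF this] obtain g
    where "(\<lambda>s. poly q s - g * s ^ m) \<in> O[at_right 0](\<lambda>s. s ^ Suc m)" ..
  from sum_in_bigo(1)[OF q this] show ?thesis by (intro exI[of _ g]) simp
qed

section \<open>The force along polynomial paths and the recursion for the coefficients\<close>

lemma norm_bigo_componentwise:
  fixes f :: "'a \<Rightarrow> real^'d^'N"
  assumes "\<And>i l. (\<lambda>x. f x $ i $ l) \<in> O[F](g)"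
  shows "(\<lambda>x. norm (f x)) \<in> O[F](g)"
proof -
  have "(\<lambda>x. \<Sum>i\<in>UNIV. \<Sum>l\<in>UNIV. \<bar>f x $ i $ l\<bar>) \<in> O[F](g)"
    using assms by (intro big_sum_in_bigo) auto
  moreover have "(\<lambda>x. norm (f x)) \<in> O[F](\<lambda>x. \<Sum>i\<in>UNIV. \<Sum>l\<in>UNIV. \<bar>f x $ i $ l\<bar>)"
  proof (rule bigoI[of _ 1], rule always_eventually, rule allI)
    fix x
    have "norm (f x) \<le> (\<Sum>i\<in>UNIV. norm (f x $ i))" by (rule norm_vec_le_sum)
    also have "\<dots> \<le> (\<Sum>i\<in>UNIV. \<Sum>l\<in>UNIV. \<bar>f x $ i $ l\<bar>)"
      using norm_vec_le_sum[of "f x $ i" for i] by (intro sum_mono) simp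
    finally have "norm (f x) \<le> (\<Sum>i\<in>UNIV. \<Sum>l\<in>UNIV. \<bar>f x $ i $ l\<bar>)" .
    then show "norm (norm (f x)) \<le> 1 * norm (\<Sum>i\<in>UNIV. \<Sum>l\<in>UNIV. \<bar>f x $ i $ l\<bar>)" by simp
  qed
  ultimately show ?thesis using landau_o.big_trans by blast
qed

text \<open>At s = t^(-p) and multiplied by t this is t v + \<Sum> c_k t^(1-kp). The constant x is
  kept out: after division by t it gives x / t, in general not a natural power of s.\<close>

definition poly_path :: "real^'d^'N \<Rightarrow> (nat \<Rightarrow> real^'d^'N) \<Rightarrow> nat \<Rightarrow> real \<Rightarrow> real^'d^'N" where
  "poly_path v c n s = v + (\<Sum>k=1..n. s ^ k *\<^sub>R c k)"

lemma poly_path_0 [simp]: "poly_path v c n 0 = v"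
  by (simp add: poly_path_def zero_power)

lemma poly_path_component: "\<exists>q. \<forall>s. poly_path v c n s $ i $ l = poly q s"
  by (rule exI[of _ "[:v $ i $ l:] + (\<Sum>k=1..n. monom (c k $ i $ l) k)"])
    (simp add: poly_path_def poly_sum poly_monom mult.commute)

text \<open>Squared distances along the path are polynomials in s, positive at 0 because
  \<open>v\<close> is collision free. Since 1 / |z|^(p+2) = (|z|^2)^(-(p+2)/2), every component is a
  finite combination of polynomials times real powers of such polynomials.\<close>

lemma taylor_expandable_force_poly_path:
  fixes v :: "real^'d^'N"
  assumes "v \<in> collision_free"
  shows "taylor_expandable (\<lambda>s. force m p (poly_path v c n s) $ i $ l)"
proof -
  obtain Q where Q: "\<And>i l s. poly_path v c n s $ i $ l = poly (Q i l) s"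
    using poly_path_component[of v c n] by metis
  define R where "R = (\<lambda>i j. \<Sum>l\<in>UNIV. (Q i l - Q j l)\<^sup>2)"
  have R: "(norm (poly_path v c n s $ i - poly_path v c n s $ j))\<^sup>2 = poly (R i j) s" for i j s
    by (simp add: R_def poly_sum Q norm_vec_def L2_set_def sum_nonneg)
  have R0: "poly (R i j) 0 > 0" if "i \<noteq> j" for i j
  proof -
    have "poly (R i j) 0 = (norm (v $ i - v $ j))\<^sup>2" using R[of 0 i j] by simp
    then show ?thesis using that assms by (simp add: collision_free_def)
  qed
  have kernel: "1 / norm z powr (p + 2) = (norm z)\<^sup>2 powr (-(p + 2) / 2)" for z :: "real^'d"
  proof -
    have "(norm z)\<^sup>2 = norm z powr 2" by (cases "z = 0") auto
    then have "(norm z)\<^sup>2 powr (-(p + 2) / 2) = norm z powr (2 * (-(p + 2) / 2))"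
      by (simp only: powr_powr)
    also have "2 * (-(p + 2) / 2) = -(p + 2)" by simp
    finally show ?thesis by (simp only: powr_minus_divide)
  qed
  have "force m p (poly_path v c n s) $ i $ l
      = - (\<Sum>j\<in>UNIV - {i}. m j * (poly (R i j) s powr (-(p + 2) / 2) * poly (Q i l - Q j l) s))" for s
  proof -
    have "m j / norm (poly_path v c n s $ i - poly_path v c n s $ j) powr (p + 2)
        = m j * poly (R i j) s powr (-(p + 2) / 2)" for j
      using kernel[of "poly_path v c n s $ i - poly_path v c n s $ j"] unfolding R
      by (metis mult.right_neutral times_divide_eq_right)
    then show ?thesis by (simp add: force_def Q mult.assoc)
  qed
  then show ?thesis
    using R0 by (simp only:) (intro taylor_expandable_minus taylor_expandable_sum taylor_expandable_cmult
        taylor_expandable_mult taylor_expandable_poly_powr taylor_expandable_poly, auto)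
qed

text \<open>The cone estimate at time 1 is a Lipschitz bound in a ball around \<open>v\<close>,
  which both families eventually enter.\<close>

lemma force_diff_bigo:
  fixes a b :: "'x \<Rightarrow> real^'d^'N" and v :: "real^'d^'N"
  assumes "\<And>i. m i > 0" "p > 0" "v \<in> collision_free" and a: "(a \<longlongrightarrow> v) F" and b: "(b \<longlongrightarrow> v) F"
  shows "(\<lambda>x. norm (force m p (a x) - force m p (b x))) \<in> O[F](\<lambda>x. norm (a x - b x))"
proof -
  obtain \<delta> L where \<delta>: "\<delta> > 0" and L: "L > 0"
    and lip: "\<And>t a b. t > 0 \<Longrightarrow> norm (a - t *\<^sub>R v) \<le> \<delta> * t \<Longrightarrow> norm (b - t *\<^sub>R v) \<le> \<delta> * t \<Longrightarrow>
      norm (force m p a - force m p b) \<le> L * t powr (-2 - p) * norm (a - b)"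
    by (rule force_lipschitz_on_cone[of m p v, OF assms(1-3)]) (rule that)
  show ?thesis
  proof (rule bigoI[of _ L])
    show "\<forall>\<^sub>F x in F. norm (norm (force m p (a x) - force m p (b x))) \<le> L * norm (norm (a x - b x))"
      using tendstoD[OF a \<delta>] tendstoD[OF b \<delta>]
    proof eventually_elim
      case (elim x)
      then show ?case using lip[of 1 "a x" "b x"] by (simp add: dist_norm)
    qed
  qed
qed

lemma poly_path_tendsto: "(poly_path v c n \<longlongrightarrow> v) (at_right 0)"
proof -
  have "(poly_path v c n \<longlongrightarrow> poly_path v c n 0) (at_right 0)"
    unfolding poly_path_def by (intro tendsto_intros)
  then show ?thesis by simp
qed

text \<open>Matched terms occupy the orders 0 to n - 1, so the residual is Taylor expandable and
  O(s^n); \<open>g\<close> collects its leading coefficients. It yields the next power coefficient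
  in the recursion and the logarithmic one at resonance.\<close>

lemma next_force_coefficient:
  fixes v :: "real^'d^'N"
  assumes v: "v \<in> collision_free"
    and approx: "(\<lambda>s. norm (force m p (poly_path v c n s) - (\<Sum>k=1..n. s ^ (k - 1) *\<^sub>R b k)))
      \<in> O[at_right 0](\<lambda>s. s ^ n)"
  shows "\<exists>g. (\<lambda>s. norm (force m p (poly_path v c n s) - (\<Sum>k=1..n. s ^ (k - 1) *\<^sub>R b k) - s ^ n *\<^sub>R g))
      \<in> O[at_right 0](\<lambda>s. s ^ Suc n)"
proof -
  define \<phi> where "\<phi> = (\<lambda>s. force m p (poly_path v c n s) - (\<Sum>k=1..n. s ^ (k - 1) *\<^sub>R b k))"
  have "\<exists>g. (\<lambda>s. \<phi> s $ i $ l - g * s ^ n) \<in> O[at_right 0](\<lambda>s. s ^ Suc n)" for i l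
  proof (rule taylor_expandable_leading_coefficient)
    have "(\<lambda>s. \<phi> s $ i $ l) = (\<lambda>s. force m p (poly_path v c n s) $ i $ l
        + poly (- (\<Sum>k=1..n. monom (b k $ i $ l) (k - 1))) s)"
      by (simp add: \<phi>_def poly_sum poly_monom mult.commute fun_eq_iff)
    then show "taylor_expandable (\<lambda>s. \<phi> s $ i $ l)"
      using taylor_expandable_add[OF taylor_expandable_force_poly_path[OF v] taylor_expandable_poly] by (simp only:)
    have "norm (\<phi> s $ i $ l) \<le> 1 * norm (norm (\<phi> s))" for s
      using Finite_Cartesian_Product.norm_nth_le[of "\<phi> s" i] Finite_Cartesian_Product.norm_nth_le[of "\<phi> s $ i" l]
      by simp
    then have "(\<lambda>s. \<phi> s $ i $ l) \<in> O[at_right 0](\<lambda>s. norm (\<phi> s))"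
      by (intro bigoI[of _ 1] always_eventually allI)
    then show "(\<lambda>s. \<phi> s $ i $ l) \<in> O[at_right 0](\<lambda>s. s ^ n)"
      by (rule landau_o.big_trans) (use approx in \<open>simp add: \<phi>_def\<close>)
  qed
  then obtain g where g: "\<And>i l. (\<lambda>s. \<phi> s $ i $ l - g i l * s ^ n) \<in> O[at_right 0](\<lambda>s. s ^ Suc n)"
    by metis
  have "(\<lambda>s. norm (\<phi> s - s ^ n *\<^sub>R (\<chi> i l. g i l))) \<in> O[at_right 0](\<lambda>s. s ^ Suc n)"
    by (rule norm_bigo_componentwise) (use g in \<open>simp add: mult.commute\<close>)
  then show ?thesis unfolding \<phi>_def by blast
qed

text \<open>Induction on the order. \<open>w k\<close> stands for the factor (1-kp)(-kp) produced by
  differentiating twice; being nonzero it can be divided out to solve for the next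
  coefficient.\<close>

lemma force_expansion_coefficients:
  fixes m :: "'N::finite \<Rightarrow> real" and v :: "real^'d^'N"
  assumes m: "\<And>i. m i > 0" and p: "p > 0" and v: "v \<in> collision_free"
    and w: "\<And>k. 1 \<le> k \<Longrightarrow> k \<le> n \<Longrightarrow> w k \<noteq> 0"
  shows "\<exists>c. (\<lambda>s. norm (force m p (poly_path v c n s) - (\<Sum>k=1..n. s ^ (k - 1) *\<^sub>R (w k *\<^sub>R c k))))
      \<in> O[at_right 0](\<lambda>s. s ^ n)"
  using w
proof (induction n)
  case 0
  show ?case by (simp add: poly_path_def)
next
  case (Suc n)
  then obtain c where c: "(\<lambda>s. norm (force m p (poly_path v c n s) - (\<Sum>k=1..n. s ^ (k - 1) *\<^sub>R (w k *\<^sub>R c k))))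
      \<in> O[at_right 0](\<lambda>s. s ^ n)" by auto
  obtain g where g: "(\<lambda>s. norm (force m p (poly_path v c n s) - (\<Sum>k=1..n. s ^ (k - 1) *\<^sub>R (w k *\<^sub>R c k))
      - s ^ n *\<^sub>R g)) \<in> O[at_right 0](\<lambda>s. s ^ Suc n)"
    using next_force_coefficient[OF v c] by blast
  define c' where "c' = c(Suc n := (1 / w (Suc n)) *\<^sub>R g)"
  have path: "poly_path v c' (Suc n) s = poly_path v c n s + s ^ Suc n *\<^sub>R c' (Suc n)" for s
    by (simp add: poly_path_def c'_def)
  have sum: "(\<Sum>k=1..Suc n. s ^ (k - 1) *\<^sub>R (w k *\<^sub>R c' k))
      = (\<Sum>k=1..n. s ^ (k - 1) *\<^sub>R (w k *\<^sub>R c k)) + s ^ n *\<^sub>R g" for s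
    using Suc.prems[of "Suc n"] by (simp add: c'_def)
  \<comment> \<open>The new term moves the path by O(s^(n+1)), hence by Lipschitz continuity also
    the force, whereas the coefficient just matched has order s^n.\<close>
  have "(\<lambda>s. norm (force m p (poly_path v c' (Suc n) s) - force m p (poly_path v c n s)))
      \<in> O[at_right 0](\<lambda>s. norm (poly_path v c' (Suc n) s - poly_path v c n s))"
    by (rule force_diff_bigo[of m, OF m p v poly_path_tendsto poly_path_tendsto])
  also have "(\<lambda>s. norm (poly_path v c' (Suc n) s - poly_path v c n s)) \<in> O[at_right 0](\<lambda>s. s ^ Suc n)"
    unfolding path by (rule bigoI[of _ "norm (c' (Suc n))"]) (simp add: abs_mult power_abs mult_ac)
  finally have d: "(\<lambda>s. norm (force m p (poly_path v c' (Suc n) s) - force m p (poly_path v c n s)))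
      \<in> O[at_right 0](\<lambda>s. s ^ Suc n)" .
  have "(\<lambda>s. norm (force m p (poly_path v c' (Suc n) s) - (\<Sum>k=1..Suc n. s ^ (k - 1) *\<^sub>R (w k *\<^sub>R c' k))))
      \<in> O[at_right 0](\<lambda>s. s ^ Suc n)"
  proof (rule landau_o.big_trans[OF _ sum_in_bigo(1)[OF d g]], rule bigoI[of _ 1], rule always_eventually, rule allI)
    fix s
    show "norm (norm (force m p (poly_path v c' (Suc n) s) - (\<Sum>k=1..Suc n. s ^ (k - 1) *\<^sub>R (w k *\<^sub>R c' k))))
      \<le> 1 * norm (norm (force m p (poly_path v c' (Suc n) s) - force m p (poly_path v c n s)) +
        norm (force m p (poly_path v c n s) - (\<Sum>k=1..n. s ^ (k - 1) *\<^sub>R (w k *\<^sub>R c k)) - s ^ n *\<^sub>R g))"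
      unfolding sum
      using norm_triangle_ineq[of "force m p (poly_path v c' (Suc n) s) - force m p (poly_path v c n s)"
        "force m p (poly_path v c n s) - (\<Sum>k=1..n. s ^ (k - 1) *\<^sub>R (w k *\<^sub>R c k)) - s ^ n *\<^sub>R g"]
      by (simp add: algebra_simps)
  qed
  then show ?case by blast
qed

subsection \<open>The approximate solution\<close>

lemma powr_scaleR_has_vector_derivative:
  fixes c :: "'a::real_normed_vector"
  assumes "t > 0"
  shows "((\<lambda>t. (a * t powr r) *\<^sub>R c) has_vector_derivative (a * r * t powr (r - 1)) *\<^sub>R c) (at t)"
proof -
  have "((\<lambda>t. a * t powr r) has_real_derivative a * (r * t powr (r - 1))) (at t)"
    by (intro DERIV_cmult has_real_derivative_powr assms)
  from has_vector_derivative_scaleR[OF this has_vector_derivative_const[of c]]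
  show ?thesis by (simp add: mult_ac)
qed

lemma powr_filterlim_at_right_0:
  assumes "p > 0"
  shows "filterlim (\<lambda>t::real. t powr (-p)) (at_right 0) at_top"
  unfolding filterlim_at
proof
  show "((\<lambda>t::real. t powr (-p)) \<longlongrightarrow> 0) at_top"
    using assms by (intro tendsto_neg_powr filterlim_ident) auto
  show "\<forall>\<^sub>F t::real in at_top. t powr (-p) \<in> {0<..} \<and> t powr (-p) \<noteq> 0"
    using eventually_gt_at_top[of 0] by eventually_elim simp
qed

text \<open>Homogeneity pulls out t^(-p-1). What remains is the effect of the perturbation
  \<open>e\<close> of the polynomial path plus the truncation error of order s^N; \<open>k\<close>
  is a common bound for both.\<close>

lemma defect_bigo:
  fixes m :: "'N::finite \<Rightarrow> real" and v :: "real^'d^'N"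
  assumes m: "\<And>i. m i > 0" and p: "p > 0" and v: "v \<in> collision_free"
    and A: "\<And>t. t > 0 \<Longrightarrow> A t = t *\<^sub>R (poly_path v c n (t powr (-p)) + e t)"
    and G: "\<And>t. t > 0 \<Longrightarrow> G t = t powr (-p - 1) *\<^sub>R S (t powr (-p))"
    and e: "(\<lambda>t. norm (e t)) \<in> O[at_top](k)" and e0: "(e \<longlongrightarrow> 0) at_top"
    and S: "(\<lambda>s. norm (force m p (poly_path v c n s) - S s)) \<in> O[at_right 0](\<lambda>s. s ^ N)"
    and N: "(\<lambda>t. (t powr (-p)) ^ N) \<in> O[at_top](k)"
  shows "((\<lambda>t. norm (A t - t *\<^sub>R v) / t) \<longlongrightarrow> 0) at_top"
    "(\<lambda>t. norm (force m p (A t) - G t)) \<in> O[at_top](\<lambda>t. t powr (-p - 1) * k t)"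
proof -
  define b where "b = (\<lambda>t. poly_path v c n (t powr (-p)))"
  define a where "a = (\<lambda>t. b t + e t)"
  have lim: "(b \<longlongrightarrow> v) at_top"
    unfolding b_def by (rule filterlim_compose[OF poly_path_tendsto powr_filterlim_at_right_0[OF p]])
  have lima: "(a \<longlongrightarrow> v) at_top"
    unfolding a_def using tendsto_add[OF lim e0] by simp
  have "((\<lambda>t. norm (a t - v)) \<longlongrightarrow> 0) at_top"
    by (intro tendsto_norm_zero) (use lima in \<open>simp add: LIM_zero_iff\<close>)
  then show "((\<lambda>t. norm (A t - t *\<^sub>R v) / t) \<longlongrightarrow> 0) at_top"
  proof (rule Lim_transform_eventually)
    show "\<forall>\<^sub>F t in at_top. norm (a t - v) = norm (A t - t *\<^sub>R v) / t"
      using eventually_gt_at_top[of 0]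
    proof eventually_elim
      case (elim t)
      have "A t - t *\<^sub>R v = t *\<^sub>R (a t - v)"
        using A[OF elim] by (simp add: a_def b_def scaleR_diff_right)
      then show ?case using elim by simp
    qed
  qed
  have "(\<lambda>t. norm (force m p (a t) - force m p (b t))) \<in> O[at_top](\<lambda>t. norm (a t - b t))"
    by (rule force_diff_bigo[of m, OF m p v lima lim])
  also have "(\<lambda>t. norm (a t - b t)) \<in> O[at_top](k)" using e by (simp add: a_def)
  finally have 1: "(\<lambda>t. norm (force m p (a t) - force m p (b t))) \<in> O[at_top](k)" .
  have 2: "(\<lambda>t. norm (force m p (b t) - S (t powr (-p)))) \<in> O[at_top](k)"
    using landau_o.big_trans[OF landau_o.big.compose[OF S powr_filterlim_at_right_0[OF p]] N]
    by (simp add: b_def)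
  have "(\<lambda>t. norm (force m p (A t) - G t))
      \<in> O[at_top](\<lambda>t. t powr (-p - 1) * (norm (force m p (a t) - force m p (b t)) + norm (force m p (b t) - S (t powr (-p)))))"
  proof (rule bigoI[of _ 1])
    show "\<forall>\<^sub>F t in at_top. norm (norm (force m p (A t) - G t))
      \<le> 1 * norm (t powr (-p - 1) * (norm (force m p (a t) - force m p (b t)) + norm (force m p (b t) - S (t powr (-p)))))"
      using eventually_gt_at_top[of 0]
    proof eventually_elim
      case (elim t)
      have "force m p (A t) - G t = t powr (-p - 1) *\<^sub>R (force m p (a t) - S (t powr (-p)))"
        using A[OF elim] G[OF elim] force_scaleR[OF elim, of m p "a t"]
        by (simp add: a_def b_def scaleR_diff_right)
      then have "norm (force m p (A t) - G t) = t powr (-p - 1) * norm (force m p (a t) - S (t powr (-p)))"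
        by simp
      also have "\<dots> \<le> t powr (-p - 1) * (norm (force m p (a t) - force m p (b t)) + norm (force m p (b t) - S (t powr (-p))))"
        using norm_triangle_ineq[of "force m p (a t) - force m p (b t)" "force m p (b t) - S (t powr (-p))"]
        by (intro mult_left_mono) auto
      finally show ?case by simp
    qed
  qed
  also have "(\<lambda>t. t powr (-p - 1) * (norm (force m p (a t) - force m p (b t)) + norm (force m p (b t) - S (t powr (-p)))))
      \<in> O[at_top](\<lambda>t. t powr (-p - 1) * k t)"
    by (intro landau_o.big.mult_left sum_in_bigo 1 2)
  finally show "(\<lambda>t. norm (force m p (A t) - G t)) \<in> O[at_top](\<lambda>t. t powr (-p - 1) * k t)" .
qed

lemma scaleR_poly_path_powr:
  assumes "t > 0"
  shows "t *\<^sub>R poly_path v c n (t powr (-p)) = t *\<^sub>R v + (\<Sum>k=1..n. (t powr (1 - real k * p)) *\<^sub>R c k)"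
proof -
  have "t * (t powr (-p)) ^ k = t powr (1 - real k * p)" for k
  proof -
    have "(t powr (-p)) ^ k = t powr (real k * (-p))"
      using assms by (simp add: powr_power)
    then have "t * (t powr (-p)) ^ k = t powr 1 * t powr (real k * (-p))"
      using assms by simp
    also have "\<dots> = t powr (1 + real k * (-p))"
      by (simp only: powr_add)
    also have "1 + real k * (-p) = 1 - real k * p" by simp
    finally show ?thesis .
  qed
  then show ?thesis by (simp add: poly_path_def scaleR_add_right scaleR_sum_right)
qed

text \<open>Half of the exponent p is sacrificed to absorb the growth of the logarithm. With y =
  (u/t)^(p/2), the inequality ln y <= y - 1 gives ln (u/t) <= (2/p)(y - 1), and the threshold exp
  (2/p) makes 2/p <= ln t.\<close>

lemma powr_ln_weight_decay:
  fixes t u p :: real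
  assumes p: "p > 0" and t: "exp (2 / p) \<le> t" "t \<le> u"
  shows "u powr (-p) * ln u \<le> t powr (-p) * ln t * (t / u) powr (p / 2)"
proof -
  have t0: "t > 0" using t(1) exp_gt_zero[of "2 / p"] by linarith
  have u0: "u > 0" using t0 t(2) by linarith
  have ln_t: "2 / p \<le> ln t" using t(1) t0 by (simp add: ln_ge_iff)
  have "ln ((u / t) powr (p / 2)) \<le> (u / t) powr (p / 2) - 1"
    using t0 u0 by (intro ln_le_minus_one) auto
  then have "p / 2 * ln (u / t) \<le> (u / t) powr (p / 2) - 1"
    using t0 u0 by (simp add: ln_powr)
  then have "2 / p * (p / 2 * ln (u / t)) \<le> 2 / p * ((u / t) powr (p / 2) - 1)"
    using p by (intro mult_left_mono) auto
  then have "ln (u / t) \<le> 2 / p * ((u / t) powr (p / 2) - 1)" using p by simp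
  also have "\<dots> \<le> ln t * ((u / t) powr (p / 2) - 1)"
  proof (rule mult_right_mono[OF ln_t])
    have "1 \<le> u / t" using t(2) t0 by simp
    then show "0 \<le> (u / t) powr (p / 2) - 1" using p ge_one_powr_ge_zero[of "u / t" "p / 2"] by simp
  qed
  finally have "ln u \<le> ln t * (u / t) powr (p / 2)"
    using t0 u0 by (simp add: ln_div algebra_simps)
  then have "u powr (-p) * ln u \<le> u powr (-p) * (ln t * (u / t) powr (p / 2))"
    by (intro mult_left_mono) auto
  also have "\<dots> = t powr (-p) * ln t * (t / u) powr (p / 2)"
  proof -
    have uu: "u powr (-p) * u powr (p / 2) = u powr (-(p / 2))" "t powr (-p) * t powr (p / 2) = t powr (-(p / 2))"
      unfolding powr_add[symmetric] by simp_all
    have "u powr (-p) * (u / t) powr (p / 2) = u powr (-p) * u powr (p / 2) * t powr (-(p / 2))"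
      using t0 u0 by (simp add: powr_divide powr_minus_divide)
    also have "\<dots> = t powr (-p) * t powr (p / 2) * u powr (-(p / 2))"
      unfolding uu by (rule mult.commute)
    also have "\<dots> = t powr (-p) * (t / u) powr (p / 2)"
      using t0 u0 by (simp add: powr_divide powr_minus_divide)
    finally show ?thesis by (simp add: mult_ac)
  qed
  finally show ?thesis .
qed

section \<open>The power part of the approximate solution and its derivatives\<close>

context
  fixes p :: real and n :: nat and x v :: "real^'d^'N" and c :: "nat \<Rightarrow> real^'d^'N"
begin

definition approx_position :: "real \<Rightarrow> real^'d^'N" where
  "approx_position t = x + t *\<^sub>R v + (\<Sum>k=1..n. (t powr (1 - real k * p)) *\<^sub>R c k)"

definition approx_velocity :: "real \<Rightarrow> real^'d^'N" where
  "approx_velocity t = v + (\<Sum>k=1..n. ((1 - real k * p) * t powr (- real k * p)) *\<^sub>R c k)"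

definition approx_acceleration :: "real \<Rightarrow> real^'d^'N" where
  "approx_acceleration t = (\<Sum>k=1..n. ((1 - real k * p) * (- real k * p) * t powr (- real k * p - 1)) *\<^sub>R c k)"

lemma approx_position_derivative:
  assumes "t > 0"
  shows "(approx_position has_vector_derivative approx_velocity t) (at t)"
proof -
  have "((\<lambda>t. (t powr (1 - real k * p)) *\<^sub>R c k) has_vector_derivative
      ((1 - real k * p) * t powr (- real k * p)) *\<^sub>R c k) (at t)" for k
    using powr_scaleR_has_vector_derivative[OF assms, of 1 "1 - real k * p" "c k"] by simp
  moreover have "((\<lambda>t. x + t *\<^sub>R v) has_vector_derivative v) (at t)"
    by (auto intro!: derivative_eq_intros)
  ultimately show ?thesis
    unfolding approx_position_def[abs_def] approx_velocity_def
    by (intro has_vector_derivative_add has_vector_derivative_sum)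
qed

lemma approx_velocity_derivative:
  assumes "t > 0"
  shows "(approx_velocity has_vector_derivative approx_acceleration t) (at t)"
proof -
  have "((\<lambda>t. v + (\<Sum>k=1..n. ((1 - real k * p) * t powr (- real k * p)) *\<^sub>R c k))
      has_vector_derivative 0 + approx_acceleration t) (at t)"
    unfolding approx_acceleration_def
    by (intro has_vector_derivative_add has_vector_derivative_sum has_vector_derivative_const
        powr_scaleR_has_vector_derivative assms)
  then show ?thesis by (simp add: approx_velocity_def[abs_def])
qed

lemma continuous_on_approx_acceleration: "T > 0 \<Longrightarrow> continuous_on {T..} approx_acceleration"
  unfolding approx_acceleration_def[abs_def]
  by (intro continuous_on_sum continuous_on_scaleR continuous_on_mult continuous_on_const
      continuous_on_powr continuous_on_id) auto

lemma approx_position_eq: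
  assumes "t > 0"
  shows "approx_position t = t *\<^sub>R (poly_path v c n (t powr (-p)) + (1 / t) *\<^sub>R x)"
  using assms scaleR_poly_path_powr[OF assms, of v c n p]
  by (simp add: approx_position_def scaleR_add_right)

lemma approx_acceleration_eq:
  assumes "t > 0"
  shows "approx_acceleration t = t powr (-p - 1) *\<^sub>R
    (\<Sum>k=1..n. (t powr (-p)) ^ (k - 1) *\<^sub>R (((1 - real k * p) * (- real k * p)) *\<^sub>R c k))"
proof -
  \<comment> \<open>The exponent k - 1 is a truncated difference of naturals; k >= 1 makes it
    genuine.\<close>
  have "t powr (- real k * p - 1) = t powr (-p - 1) * (t powr (-p)) ^ (k - 1)" if "k \<in> {1..n}" for k
  proof -
    have "(t powr (-p)) ^ (k - 1) = t powr (real (k - 1) * (-p))"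
      using assms by (simp add: powr_power)
    then have "t powr (-p - 1) * (t powr (-p)) ^ (k - 1) = t powr ((-p - 1) + real (k - 1) * (-p))"
      by (simp only: powr_add)
    also have "(-p - 1) + real (k - 1) * (-p) = - real k * p - 1"
      using that by (simp add: of_nat_diff algebra_simps)
    finally show ?thesis ..
  qed
  then show ?thesis
    unfolding approx_acceleration_def scaleR_sum_right
    by (intro sum.cong refl) (simp only: scaleR_scaleR mult_ac)
qed

end

section \<open>The nonresonant and the resonant expansion\<close>

lemma recip_tendsto_0: "((\<lambda>t::real. (1 / t) *\<^sub>R (x :: 'a::real_normed_vector)) \<longlongrightarrow> 0) at_top"
  using tendsto_scaleR[OF tendsto_divide_0[OF tendsto_const filterlim_at_top_imp_at_infinity[OF filterlim_ident]]
    tendsto_const[of x]] by simp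

text \<open>Since n p < 1, the perturbation x / t is no larger than the truncation error t^(-np).
  Their common defect t^(-p-1) t^(-np) equals h / t^2 with h = t^(1-(n+1)p), which decays because
  (n+1) p > 1.\<close>

lemma nbody_expansion_subcritical:
  fixes m :: "'N::finite \<Rightarrow> real" and p :: real and n :: nat and v :: "real^'d^'N"
  assumes m: "\<And>i. m i > 0" and p: "p > 0" and v: "v \<in> collision_free"
    and np: "real n * p < 1" and np1: "(real n + 1) * p > 1"
  shows "\<exists>c :: nat \<Rightarrow> real^'d^'N. \<forall>x :: real^'d^'N. \<exists>T0>0.
    has_unique_nbody_solution m p T0 (\<lambda>\<alpha> \<beta>.
      (\<lambda>t. norm (\<alpha> t - (x + t *\<^sub>R v + (\<Sum>k=1..n. (t powr (1 - real k * p)) *\<^sub>R c k))))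
        \<in> O[at_top](\<lambda>t. t powr (1 - (real n + 1) * p)) \<and>
      (\<lambda>t. norm (\<beta> t - (v + (\<Sum>k=1..n. ((1 - real k * p) * t powr (- real k * p)) *\<^sub>R c k))))
        \<in> O[at_top](\<lambda>t. t powr (- (real n + 1) * p)))"
proof -
  define w where "w = (\<lambda>k. (1 - real k * p) * (- real k * p))"
  have "w k \<noteq> 0" if "1 \<le> k" "k \<le> n" for k
  proof -
    have "real k * p \<le> real n * p" using that p by (intro mult_right_mono) auto
    then have "real k * p \<noteq> 1" using np by linarith
    then show ?thesis using that p by (simp add: w_def)
  qed
  \<comment> \<open>The coefficients are fixed here, before any \<open>x\<close> is introduced; this
    gives their independence of \<open>x\<close>.\<close>
  then obtain c where c: "(\<lambda>s. norm (force m p (poly_path v c n s) - (\<Sum>k=1..n. s ^ (k - 1) *\<^sub>R (w k *\<^sub>R c k))))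
      \<in> O[at_right 0](\<lambda>s. s ^ n)"
    using force_expansion_coefficients[of m p v n w, OF m p v] by blast
  define h where "h = (\<lambda>t. t powr (1 - (real n + 1) * p))"
  define \<eta> where "\<eta> = (real n + 1) * p - 1"
  have h_eta: "h = (\<lambda>t. t powr (-\<eta>))" by (simp add: h_def \<eta>_def)
  have \<eta>: "\<eta> > 0" using np1 by (simp add: \<eta>_def)
  have sol: "\<exists>T0>0. has_unique_nbody_solution m p T0 (\<lambda>\<alpha> \<beta>.
      (\<lambda>t. norm (\<alpha> t - approx_position p n x v c t)) \<in> O[at_top](h) \<and>
      (\<lambda>t. norm (\<beta> t - approx_velocity p n v c t)) \<in> O[at_top](\<lambda>t. h t / t))" for x
  proof -
    have e: "(\<lambda>t. norm ((1 / t) *\<^sub>R x)) \<in> O[at_top](\<lambda>t. t powr (- (real n * p)))"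
    proof (rule bigoI[of _ "norm x"])
      show "\<forall>\<^sub>F t in at_top. norm (norm ((1 / t) *\<^sub>R x)) \<le> norm x * norm (t powr (- (real n * p)))"
        using eventually_ge_at_top[of 1]
      proof eventually_elim
        case (elim t)
        have "t powr (-1) \<le> t powr (- (real n * p))"
          using elim np by (intro powr_mono) auto
        then have "norm x * t powr (-1) \<le> norm x * t powr (- (real n * p))"
          by (intro mult_left_mono) auto
        then show ?case using elim by (simp add: powr_minus_divide)
      qed
    qed
    have N: "(\<lambda>t. (t powr (-p)) ^ n) \<in> O[at_top](\<lambda>t. t powr (- (real n * p)))"
    proof (rule bigoI[of _ 1])
      show "\<forall>\<^sub>F t in at_top. norm ((t powr (-p)) ^ n) \<le> 1 * norm (t powr (- (real n * p)))"
        using eventually_gt_at_top[of 0] by eventually_elim (simp add: powr_power)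
    qed
    have heq: "\<forall>\<^sub>F t in at_top. t powr (-p - 1) * t powr (- (real n * p)) = h t / t\<^sup>2"
      using eventually_gt_at_top[of 0]
    proof eventually_elim
      case (elim t)
      have "h t / t\<^sup>2 = t powr (1 - (real n + 1) * p) / t powr 2"
        using elim by (simp add: h_def)
      also have "\<dots> = t powr (1 - (real n + 1) * p - 2)" by (simp only: powr_diff)
      also have "1 - (real n + 1) * p - 2 = (-p - 1) + (- (real n * p))" by (simp add: algebra_simps)
      finally show ?case by (simp only: powr_add)
    qed
    have acc: "approx_acceleration p n c t = t powr (-p - 1) *\<^sub>R
        (\<Sum>k=1..n. (t powr (-p)) ^ (k - 1) *\<^sub>R (w k *\<^sub>R c k))" if "t > 0" for t
      unfolding w_def by (rule approx_acceleration_eq[OF that])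
    note defect = defect_bigo[of m p v "approx_position p n x v c" c n "\<lambda>t. (1 / t) *\<^sub>R x"
        "approx_acceleration p n c" "\<lambda>s. \<Sum>k=1..n. s ^ (k - 1) *\<^sub>R (w k *\<^sub>R c k)"
        "\<lambda>t. t powr (- (real n * p))" n, OF m p v approx_position_eq acc e recip_tendsto_0 c N]
    show ?thesis
    proof (rule nbody_solution_near_approximation[of m p v \<eta> 1, OF m p v \<eta>])
      show "(approx_position p n x v c has_vector_derivative approx_velocity p n v c t) (at t)" if "t \<ge> 1" for t
        using that by (intro approx_position_derivative) simp
      show "(approx_velocity p n v c has_vector_derivative approx_acceleration p n c t) (at t)" if "t \<ge> 1" for t
        using that by (intro approx_velocity_derivative) simp
      show "continuous_on {1..} (approx_acceleration p n c)"
        by (intro continuous_on_approx_acceleration) simp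
      show "((\<lambda>t. norm (approx_position p n x v c t - t *\<^sub>R v) / t) \<longlongrightarrow> 0) at_top"
        by (rule defect(1))
      show "(\<lambda>t. norm (force m p (approx_position p n x v c t) - approx_acceleration p n c t))
          \<in> O[at_top](\<lambda>t. h t / t\<^sup>2)"
        using defect(2) unfolding landau_o.big.cong[OF heq] .
      show "h t \<ge> 0" for t by (simp add: h_def)
      show "h u \<le> h t * (t / u) powr \<eta>" if "1 \<le> t" "t \<le> u" for t u
        using that by (simp add: h_eta powr_divide powr_minus_divide)
    qed simp
  qed
  have hO: "O[at_top](\<lambda>t. h t / t) = O[at_top](\<lambda>t. t powr (- (real n + 1) * p))"
  proof (rule landau_o.big.cong)
    show "\<forall>\<^sub>F t in at_top. h t / t = t powr (- (real n + 1) * p)"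
      using eventually_gt_at_top[of 0]
    proof eventually_elim
      case (elim t)
      have "h t / t = t powr (1 - (real n + 1) * p) / t powr 1"
        using elim by (simp add: h_def)
      also have "\<dots> = t powr (1 - (real n + 1) * p - 1)" by (simp only: powr_diff)
      also have "1 - (real n + 1) * p - 1 = - (real n + 1) * p" by (simp add: algebra_simps)
      finally show ?case .
    qed
  qed
  show ?thesis
    using sol unfolding hO unfolding h_def approx_position_def approx_velocity_def
    by (intro exI[of _ c] allI)
qed

text \<open>At (n+1) p = 1 the factor (1-kp)(-kp) vanishes for k = n + 1, and the coefficient
  \<open>g\<close> of s^n in the force must be matched otherwise: t^(-p-1) s^n is t^(-2), the second
  derivative of -ln t. The weight is t^(-p) ln t because the logarithmic term perturbs the path by
  (ln t) / t.\<close>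

lemma nbody_expansion_critical:
  fixes m :: "'N::finite \<Rightarrow> real" and p :: real and n :: nat and v :: "real^'d^'N"
  assumes m: "\<And>i. m i > 0" and p: "p > 0" and v: "v \<in> collision_free"
    and np1: "(real n + 1) * p = 1"
  shows "\<exists>c :: nat \<Rightarrow> real^'d^'N. \<forall>x :: real^'d^'N. \<exists>T0>0.
    has_unique_nbody_solution m p T0 (\<lambda>\<alpha> \<beta>.
      (\<lambda>t. norm (\<alpha> t - (x + t *\<^sub>R v + (\<Sum>k=1..n. (t powr (1 - real k * p)) *\<^sub>R c k) + ln t *\<^sub>R c (n + 1))))
        \<in> O[at_top](\<lambda>t. t powr (1 - (real n + 2) * p) * ln t) \<and>
      (\<lambda>t. norm (\<beta> t - (v + (\<Sum>k=1..n. ((1 - real k * p) * t powr (- real k * p)) *\<^sub>R c k) + (1 / t) *\<^sub>R c (n + 1))))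
        \<in> O[at_top](\<lambda>t. t powr (- (real n + 2) * p) * ln t))"
proof -
  define w where "w = (\<lambda>k. (1 - real k * p) * (- real k * p))"
  have "w k \<noteq> 0" if "1 \<le> k" "k \<le> n" for k
  proof -
    have "real k * p < (real n + 1) * p" using that p by (intro mult_strict_right_mono) auto
    then have "real k * p \<noteq> 1" using np1 by linarith
    then show ?thesis using that p by (simp add: w_def)
  qed
  then obtain c where c: "(\<lambda>s. norm (force m p (poly_path v c n s) - (\<Sum>k=1..n. s ^ (k - 1) *\<^sub>R (w k *\<^sub>R c k))))
      \<in> O[at_right 0](\<lambda>s. s ^ n)"
    using force_expansion_coefficients[of m p v n w, OF m p v] by blast
  obtain g where g: "(\<lambda>s. norm (force m p (poly_path v c n s) - (\<Sum>k=1..n. s ^ (k - 1) *\<^sub>R (w k *\<^sub>R c k))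
      - s ^ n *\<^sub>R g)) \<in> O[at_right 0](\<lambda>s. s ^ Suc n)"
    using next_force_coefficient[OF v c] by blast
  define S where "S = (\<lambda>s. (\<Sum>k=1..n. s ^ (k - 1) *\<^sub>R (w k *\<^sub>R c k)) + s ^ n *\<^sub>R g)"
  have S: "(\<lambda>s. norm (force m p (poly_path v c n s) - S s)) \<in> O[at_right 0](\<lambda>s. s ^ Suc n)"
    using g by (simp add: S_def diff_diff_eq)
  \<comment> \<open>The sign comes from (ln t)'' = -1 / t^2.\<close>
  define d where "d = - g"
  \<comment> \<open>Stores the logarithmic coefficient at index n + 1, which the sums over 1..n
    never read.\<close>
  define c' where "c' = c(n + 1 := d)"
  define h where "h = (\<lambda>t. t powr (1 - (real n + 2) * p) * ln t)"
  have hp: "1 - (real n + 2) * p = -p" using np1 by (simp add: algebra_simps)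
  have h_p: "h = (\<lambda>t. t powr (-p) * ln t)" unfolding h_def hp ..
  have sol: "\<exists>T0>0. has_unique_nbody_solution m p T0 (\<lambda>\<alpha> \<beta>.
      (\<lambda>t. norm (\<alpha> t - (approx_position p n x v c t + ln t *\<^sub>R d))) \<in> O[at_top](h) \<and>
      (\<lambda>t. norm (\<beta> t - (approx_velocity p n v c t + (1 / t) *\<^sub>R d))) \<in> O[at_top](\<lambda>t. h t / t))" for x
  proof -
    define A where "A = (\<lambda>t. approx_position p n x v c t + ln t *\<^sub>R d)"
    define B where "B = (\<lambda>t. approx_velocity p n v c t + (1 / t) *\<^sub>R d)"
    define G where "G = (\<lambda>t. approx_acceleration p n c t + (- 1 / t\<^sup>2) *\<^sub>R d)"
    define e where "e = (\<lambda>t. (1 / t) *\<^sub>R x + (ln t / t) *\<^sub>R d)"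
    have A: "A t = t *\<^sub>R (poly_path v c n (t powr (-p)) + e t)" if "t > 0" for t
      using approx_position_eq[OF that, of p n x v c] that
      by (simp add: A_def e_def scaleR_add_right)
    have G: "G t = t powr (-p - 1) *\<^sub>R S (t powr (-p))" if "t > 0" for t
    proof -
      have "(t powr (-p)) ^ n = t powr (real n * (-p))"
        using that by (simp add: powr_power)
      then have "t powr (-p - 1) * (t powr (-p)) ^ n = t powr ((-p - 1) + real n * (-p))"
        by (simp only: powr_add)
      also have "(-p - 1) + real n * (-p) = -2" using np1 by (simp add: algebra_simps)
      also have "t powr (-2) = 1 / t\<^sup>2" using that by (simp add: powr_minus_divide)
      finally have "(t powr (-p - 1) * (t powr (-p)) ^ n) *\<^sub>R g = (- 1 / t\<^sup>2) *\<^sub>R d"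
        by (simp add: d_def)
      then show ?thesis
        unfolding G_def S_def scaleR_add_right approx_acceleration_eq[OF that] w_def by simp
    qed
    \<comment> \<open>From exp 1 on, ln t >= 1, so 1 / t is bounded by (ln t) / t; this bounds both
      the \<open>x\<close> term and s^(n+1) = 1 / t.\<close>
    have ln_pos: "\<forall>\<^sub>F t::real in at_top. t > 0 \<and> ln t \<ge> 1 \<and> \<bar>ln t\<bar> = ln t"
      using eventually_ge_at_top[of "exp 1"]
    proof eventually_elim
      case (elim t)
      then have "t > 0" using exp_gt_zero[of "1 :: real"] by linarith
      moreover from this have "ln t \<ge> 1" using elim by (simp add: ln_ge_iff)
      ultimately show ?case by simp
    qed
    have e: "(\<lambda>t. norm (e t)) \<in> O[at_top](\<lambda>t. ln t / t)"
    proof (rule bigoI[of _ "norm x + norm d"])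
      show "\<forall>\<^sub>F t in at_top. norm (norm (e t)) \<le> (norm x + norm d) * norm (ln t / t)"
        using ln_pos
      proof eventually_elim
        case (elim t)
        have "norm (e t) \<le> norm ((1 / t) *\<^sub>R x) + norm ((ln t / t) *\<^sub>R d)"
          unfolding e_def by (rule norm_triangle_ineq)
        also have "\<dots> = norm x * (1 / t) + norm d * (ln t / t)"
          using elim by (simp add: mult.commute)
        also have "\<dots> \<le> norm x * (ln t / t) + norm d * (ln t / t)"
          using elim by (intro add_right_mono mult_left_mono divide_right_mono) auto
        finally show ?case using elim by (simp add: distrib_right add_divide_distrib)
      qed
    qed
    have e0: "(e \<longlongrightarrow> 0) at_top"
      by (rule tendsto_norm_zero_cancel[OF bigo_tendsto_0[OF e ln_x_over_x_tendsto_0]])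
    have N: "(\<lambda>t. (t powr (-p)) ^ Suc n) \<in> O[at_top](\<lambda>t. ln t / t)"
    proof (rule bigoI[of _ 1])
      show "\<forall>\<^sub>F t in at_top. norm ((t powr (-p)) ^ Suc n) \<le> 1 * norm (ln t / t)"
        using ln_pos
      proof eventually_elim
        case (elim t)
        have "(t powr (-p)) ^ Suc n = t powr (real (Suc n) * (-p))"
          using elim by (intro powr_power) simp
        also have "real (Suc n) * (-p) = -1" using np1 by (simp add: algebra_simps)
        also have "t powr (-1) = 1 / t" using elim by (simp add: powr_minus_divide)
        finally show ?case using elim by (simp add: divide_right_mono)
      qed
    qed
    have heq: "\<forall>\<^sub>F t in at_top. t powr (-p - 1) * (ln t / t) = h t / t\<^sup>2"
      using eventually_gt_at_top[of 0]
      by eventually_elim (simp add: h_p powr_diff power2_eq_square)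
    note defect = defect_bigo[of m p v A c n e G S "\<lambda>t. ln t / t" "Suc n", OF m p v A G e e0 S N]
    have T1: "exp (2 / p) \<ge> 1" using p by simp
    have "\<exists>T0>0. has_unique_nbody_solution m p T0 (\<lambda>\<alpha> \<beta>.
      (\<lambda>t. norm (\<alpha> t - A t)) \<in> O[at_top](h) \<and> (\<lambda>t. norm (\<beta> t - B t)) \<in> O[at_top](\<lambda>t. h t / t))"
    proof (rule nbody_solution_near_approximation[of m p v "p / 2" "exp (2 / p)", OF m p v])
      have pos: "t > 0" if "t \<ge> exp (2 / p)" for t using that T1 by linarith
      show "(A has_vector_derivative B t) (at t)" if "t \<ge> exp (2 / p)" for t
      proof -
        have "(ln has_real_derivative 1 / t) (at t)"
          using pos[OF that] by (auto intro!: derivative_eq_intros simp: divide_inverse)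
        from has_vector_derivative_scaleR[OF this has_vector_derivative_const[of d]]
        show ?thesis
          unfolding A_def B_def
          by (intro has_vector_derivative_add approx_position_derivative pos that) simp
      qed
      show "(B has_vector_derivative G t) (at t)" if "t \<ge> exp (2 / p)" for t
      proof -
        have "((\<lambda>t. 1 / t) has_real_derivative - 1 / t\<^sup>2) (at t)"
          using pos[OF that] by (auto intro!: derivative_eq_intros simp: power2_eq_square)
        from has_vector_derivative_scaleR[OF this has_vector_derivative_const[of d]]
        show ?thesis
          unfolding B_def G_def
          by (intro has_vector_derivative_add approx_velocity_derivative pos that) simp
      qed
      show "continuous_on {exp (2 / p)..} G"
        unfolding G_def
        by (intro continuous_on_add continuous_on_approx_acceleration continuous_intros)
          (auto dest: pos)
      show "((\<lambda>t. norm (A t - t *\<^sub>R v) / t) \<longlongrightarrow> 0) at_top" by (rule defect(1))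
      show "(\<lambda>t. norm (force m p (A t) - G t)) \<in> O[at_top](\<lambda>t. h t / t\<^sup>2)"
        using defect(2) unfolding landau_o.big.cong[OF heq] .
      show "h t \<ge> 0" if "exp (2 / p) \<le> t" for t
        unfolding h_p using order_trans[OF T1 that] by simp
      show "h u \<le> h t * (t / u) powr (p / 2)" if "exp (2 / p) \<le> t" "t \<le> u" for t u
        unfolding h_p by (rule powr_ln_weight_decay[OF p that])
    qed (use p in simp_all)
    then show ?thesis unfolding A_def B_def .
  qed
  have hO: "O[at_top](\<lambda>t. h t / t) = O[at_top](\<lambda>t. t powr (- (real n + 2) * p) * ln t)"
  proof (rule landau_o.big.cong)
    show "\<forall>\<^sub>F t in at_top. h t / t = t powr (- (real n + 2) * p) * ln t"
      using eventually_gt_at_top[of 0]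
    proof eventually_elim
      case (elim t)
      have "h t / t = t powr (1 - (real n + 2) * p) / t powr 1 * ln t"
        using elim by (simp add: h_def)
      also have "\<dots> = t powr (1 - (real n + 2) * p - 1) * ln t" by (simp only: powr_diff)
      also have "1 - (real n + 2) * p - 1 = - (real n + 2) * p" by (simp add: algebra_simps)
      finally show ?case .
    qed
  qed
  have pos_eq: "approx_position p n x v c t
      = x + t *\<^sub>R v + (\<Sum>k=1..n. (t powr (1 - real k * p)) *\<^sub>R c' k)" for x t
    by (simp add: approx_position_def c'_def)
  have vel_eq: "approx_velocity p n v c t
      = v + (\<Sum>k=1..n. ((1 - real k * p) * t powr (- real k * p)) *\<^sub>R c' k)" for t
    by (simp add: approx_velocity_def c'_def)
  have d_eq: "d = c' (n + 1)" by (simp add: c'_def)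
  show ?thesis
    using sol unfolding hO pos_eq vel_eq unfolding h_def d_eq
    by (intro exI[of _ c'] allI)
qed

text \<open>Independence of \<open>x\<close> is encoded by the order of quantifiers:
  \<open>c\<close> is chosen before \<open>x\<close>, and \<open>T0\<close> after it.\<close>

theorem theorem1:
  fixes m :: "'N::finite \<Rightarrow> real" and p :: real and n :: nat and v :: "real^'d^'N"
  assumes "CARD('N) \<ge> 2"
    and "\<And>i. m i > 0"
    and "p > 0"
    and "1 / (real n + 1) \<le> p"
    and "n = 0 \<or> p < 1 / real n"
    and "v \<in> collision_free"
  shows "(p > 1 / (real n + 1) \<longrightarrow>
      (\<exists>c :: nat \<Rightarrow> real^'d^'N. \<forall>x :: real^'d^'N. \<exists>T0>0.
        has_unique_nbody_solution m p T0 (\<lambda>\<alpha> \<beta>.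
          (\<lambda>t. norm (\<alpha> t - (x + t *\<^sub>R v + (\<Sum>k=1..n. (t powr (1 - real k * p)) *\<^sub>R c k))))
            \<in> O[at_top](\<lambda>t. t powr (1 - (real n + 1) * p)) \<and>
          (\<lambda>t. norm (\<beta> t - (v + (\<Sum>k=1..n. ((1 - real k * p) * t powr (- real k * p)) *\<^sub>R c k))))
            \<in> O[at_top](\<lambda>t. t powr (- (real n + 1) * p))))) \<and>
    (p = 1 / (real n + 1) \<longrightarrow>
      (\<exists>c :: nat \<Rightarrow> real^'d^'N. \<forall>x :: real^'d^'N. \<exists>T0>0.
        has_unique_nbody_solution m p T0 (\<lambda>\<alpha> \<beta>.
          (\<lambda>t. norm (\<alpha> t - (x + t *\<^sub>R v + (\<Sum>k=1..n. (t powr (1 - real k * p)) *\<^sub>R c k) + ln t *\<^sub>R c (n + 1))))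
            \<in> O[at_top](\<lambda>t. t powr (1 - (real n + 2) * p) * ln t) \<and>
          (\<lambda>t. norm (\<beta> t - (v + (\<Sum>k=1..n. ((1 - real k * p) * t powr (- real k * p)) *\<^sub>R c k) + (1 / t) *\<^sub>R c (n + 1))))
            \<in> O[at_top](\<lambda>t. t powr (- (real n + 2) * p) * ln t))))"
proof (intro conjI impI)
  assume "p > 1 / (real n + 1)"
  then have "(real n + 1) * p > 1" by (simp add: field_simps)
  \<comment> \<open>For n = 0, where 1/0 is read as infinity, the product is 0.\<close>
  moreover have "real n * p < 1"
    using assms(5) by (cases "n = 0") (auto simp: field_simps)
  ultimately show "\<exists>c :: nat \<Rightarrow> real^'d^'N. \<forall>x :: real^'d^'N. \<exists>T0>0.
    has_unique_nbody_solution m p T0 (\<lambda>\<alpha> \<beta>.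
      (\<lambda>t. norm (\<alpha> t - (x + t *\<^sub>R v + (\<Sum>k=1..n. (t powr (1 - real k * p)) *\<^sub>R c k))))
        \<in> O[at_top](\<lambda>t. t powr (1 - (real n + 1) * p)) \<and>
      (\<lambda>t. norm (\<beta> t - (v + (\<Sum>k=1..n. ((1 - real k * p) * t powr (- real k * p)) *\<^sub>R c k))))
        \<in> O[at_top](\<lambda>t. t powr (- (real n + 1) * p)))"
    by (intro nbody_expansion_subcritical[of m p v n, OF assms(2,3,6)])
next
  assume "p = 1 / (real n + 1)"
  then have "(real n + 1) * p = 1" by simp
  then show "\<exists>c :: nat \<Rightarrow> real^'d^'N. \<forall>x :: real^'d^'N. \<exists>T0>0.
    has_unique_nbody_solution m p T0 (\<lambda>\<alpha> \<beta>.
      (\<lambda>t. norm (\<alpha> t - (x + t *\<^sub>R v + (\<Sum>k=1..n. (t powr (1 - real k * p)) *\<^sub>R c k) + ln t *\<^sub>R c (n + 1))))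
        \<in> O[at_top](\<lambda>t. t powr (1 - (real n + 2) * p) * ln t) \<and>
      (\<lambda>t. norm (\<beta> t - (v + (\<Sum>k=1..n. ((1 - real k * p) * t powr (- real k * p)) *\<^sub>R c k) + (1 / t) *\<^sub>R c (n + 1))))
        \<in> O[at_top](\<lambda>t. t powr (- (real n + 2) * p) * ln t))"
    by (rule nbody_expansion_critical[of m p v n, OF assms(2,3,6)])
qed

end
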